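(* Let $G$ be an arc-transitive group of automorphisms of a connected cubic symmetric graph $X=X_0$, and let $X_n\xrightarrow{\wp_n}X_{n-1}\to\cdots\to X_2\xrightarrow{\wp_2}X_1\xrightarrow{\wp_1}X_0$ be a $G$-admissible chain of consecutive $2$-covers, with lifted groups $G=G_0,G_1,\dots,G_n$. Then at most two of the $2$-covers $\wp_j$ in the chain are split (relative to $G_{j-1}$). In particular, if precisely two of them are split, then one is split-transitive and the other is split-sectional or split-mixed, and this can happen only if $G$ is $s$-regular for some $s\in\{2,3,5\}$.
   Context: Graphs are finite, simple and connected; maps are composed on the right. An $s$-arc is a sequence $(v_0,\dots,v_s)$ of vertices with $v_{i-1}\sim v_i$ and $v_{i-1}\neq v_{i+1}$; a group is $s$-regular if it acts regularly on $s$-arcs. A regular covering projection $\wp\colon\tilde Y\to Y$ is a surjective graph homomorphism, locally bijective on neighbourhoods, whose group $\mathrm{CT}(\wp)$ of covering transformations (automorphisms $c$ with $c\wp=\wp$) acts regularly on fibres; a $2$-cover has $\mathrm{CT}(\wp)\cong\mathbb{Z}_2$. A lift of $g\in\mathrm{Aut}\,Y$ is $\tilde g$ with $\wp g=\tilde g\wp$; the lifted group $\tilde K$ of $K\leq\mathrm{Aut}\,Y$ is the group of all lifts of its elements. $\wp$ is split relative to $K$ if $K$ lifts and $\mathrm{CT}(\wp)$ has a complement in $\tilde K$. A section is a vertex set meeting each fibre in exactly one vertex; a complement is sectional if it leaves a section invariant, transitive if transitive on $V(\tilde Y)$. For $K$ vertex-transitive, a $K$-split $\wp$ is split-sectional if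 all complements are sectional, split-transitive if all complements are transitive, and split-mixed if both sectional and transitive complements exist. The chain is $G$-admissible if $G_j\leq\mathrm{Aut}\,X_j$ is the lift of $G_{j-1}$ along $\wp_j$ for each $j$. *)

theory Defs
  imports Main
begin

text \<open>Finite simple graphs with vertices from a type 'v. Automorphisms are
  represented extensionally as maps 'v to 'v that permute the vertex set,
  preserve adjacency and are the identity outside the vertex set.
  Maps are composed on the right: the product "g h" (first g, then h)
  is the HOL function h o g.\<close>

record 'v graph =
  verts :: "'v set"
  adj :: "'v \<Rightarrow> 'v \<Rightarrow> bool"

definition simple_graph :: "'v graph \<Rightarrow> bool" where
  "simple_graph X \<longleftrightarrow> finite (verts X) \<and>
     (\<forall>x y. adj X x y \<longrightarrow> x \<in> verts X \<and> y \<in> verts X \<and> x \<noteq> y) \<and>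
     (\<forall>x y. adj X x y \<longrightarrow> adj X y x)"

definition connected_graph :: "'v graph \<Rightarrow> bool" where
  "connected_graph X \<longleftrightarrow> verts X \<noteq> {} \<and>
     (\<forall>x\<in>verts X. \<forall>y\<in>verts X. (adj X)\<^sup>*\<^sup>* x y)"

definition nbhd :: "'v graph \<Rightarrow> 'v \<Rightarrow> 'v set" where
  "nbhd X v = {u. adj X v u}"

definition cubic :: "'v graph \<Rightarrow> bool" where
  "cubic X \<longleftrightarrow> (\<forall>v\<in>verts X. card (nbhd X v) = 3)"

definition aut :: "'v graph \<Rightarrow> ('v \<Rightarrow> 'v) set" where
  "aut X = {g. bij_betw g (verts X) (verts X) \<and>
     (\<forall>x\<in>verts X. \<forall>y\<in>verts X. adj X (g x) (g y) \<longleftrightarrow> adj X x y) \<and>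
     (\<forall>x. x \<notin> verts X \<longrightarrow> g x = x)}"

definition aut_subgroup :: "('v \<Rightarrow> 'v) set \<Rightarrow> 'v graph \<Rightarrow> bool" where
  "aut_subgroup H X \<longleftrightarrow> H \<subseteq> aut X \<and> id \<in> H \<and>
     (\<forall>g\<in>H. \<forall>h\<in>H. h \<circ> g \<in> H) \<and> (\<forall>g\<in>H. \<exists>g'\<in>H. g' \<circ> g = id)"

definition arc_transitive :: "('v \<Rightarrow> 'v) set \<Rightarrow> 'v graph \<Rightarrow> bool" where
  "arc_transitive K X \<longleftrightarrow>
     (\<forall>u v u' v'. adj X u v \<longrightarrow> adj X u' v' \<longrightarrow> (\<exists>g\<in>K. g u = u' \<and> g v = v'))"

definition vertex_transitive :: "('v \<Rightarrow> 'v) set \<Rightarrow> 'v graph \<Rightarrow> bool" where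
  "vertex_transitive K X \<longleftrightarrow> (\<forall>y\<in>verts X. \<forall>y'\<in>verts X. \<exists>g\<in>K. g y = y')"

definition s_arc :: "'v graph \<Rightarrow> nat \<Rightarrow> 'v list \<Rightarrow> bool" where
  "s_arc X s xs \<longleftrightarrow> length xs = Suc s \<and>
     (\<forall>i<s. adj X (xs ! i) (xs ! Suc i)) \<and>
     (\<forall>i. 0 < i \<and> i < s \<longrightarrow> xs ! (i - 1) \<noteq> xs ! Suc i)"

definition s_regular :: "('v \<Rightarrow> 'v) set \<Rightarrow> 'v graph \<Rightarrow> nat \<Rightarrow> bool" where
  "s_regular K X s \<longleftrightarrow> (\<exists>xs. s_arc X s xs) \<and>
     (\<forall>xs ys. s_arc X s xs \<longrightarrow> s_arc X s ys \<longrightarrow> (\<exists>!g. g \<in> K \<and> map g xs = ys))"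

definition covering_projection :: "('v \<Rightarrow> 'v) \<Rightarrow> 'v graph \<Rightarrow> 'v graph \<Rightarrow> bool" where
  "covering_projection p Y X \<longleftrightarrow> p ` verts Y = verts X \<and>
     (\<forall>u v. adj Y u v \<longrightarrow> adj X (p u) (p v)) \<and>
     (\<forall>y\<in>verts Y. bij_betw p (nbhd Y y) (nbhd X (p y)))"

definition CT :: "('v \<Rightarrow> 'v) \<Rightarrow> 'v graph \<Rightarrow> ('v \<Rightarrow> 'v) set" where
  "CT p Y = {c \<in> aut Y. \<forall>y\<in>verts Y. p (c y) = p y}"

definition regular_covering :: "('v \<Rightarrow> 'v) \<Rightarrow> 'v graph \<Rightarrow> 'v graph \<Rightarrow> bool" where
  "regular_covering p Y X \<longleftrightarrow> covering_projection p Y X \<and>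
     (\<forall>y\<in>verts Y. \<forall>y'\<in>verts Y. p y = p y' \<longrightarrow> (\<exists>!c. c \<in> CT p Y \<and> c y = y'))"

definition two_cover :: "('v \<Rightarrow> 'v) \<Rightarrow> 'v graph \<Rightarrow> 'v graph \<Rightarrow> bool" where
  "two_cover p Y X \<longleftrightarrow> regular_covering p Y X \<and> card (CT p Y) = 2"

text \<open>g' is a lift of g: p g = g' p (right composition), i.e. g (p y) = p (g' y).\<close>
definition is_lift :: "('v \<Rightarrow> 'v) \<Rightarrow> 'v graph \<Rightarrow> ('v \<Rightarrow> 'v) \<Rightarrow> ('v \<Rightarrow> 'v) \<Rightarrow> bool" where
  "is_lift p Y g g' \<longleftrightarrow> g' \<in> aut Y \<and> (\<forall>y\<in>verts Y. p (g' y) = g (p y))"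

definition lifts :: "('v \<Rightarrow> 'v) \<Rightarrow> 'v graph \<Rightarrow> ('v \<Rightarrow> 'v) set \<Rightarrow> bool" where
  "lifts p Y K \<longleftrightarrow> (\<forall>g\<in>K. \<exists>g'. is_lift p Y g g')"

definition lifted_group :: "('v \<Rightarrow> 'v) \<Rightarrow> 'v graph \<Rightarrow> ('v \<Rightarrow> 'v) set \<Rightarrow> ('v \<Rightarrow> 'v) set" where
  "lifted_group p Y K = {g'. \<exists>g\<in>K. is_lift p Y g g'}"

definition is_complement ::
  "('v \<Rightarrow> 'v) set \<Rightarrow> ('v \<Rightarrow> 'v) \<Rightarrow> 'v graph \<Rightarrow> ('v \<Rightarrow> 'v) set \<Rightarrow> bool" where
  "is_complement H p Y K \<longleftrightarrow> aut_subgroup H Y \<and> H \<subseteq> lifted_group p Y K \<and>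
     H \<inter> CT p Y = {id} \<and> {c \<circ> h | h c. h \<in> H \<and> c \<in> CT p Y} = lifted_group p Y K"

definition split_cover :: "('v \<Rightarrow> 'v) \<Rightarrow> 'v graph \<Rightarrow> ('v \<Rightarrow> 'v) set \<Rightarrow> bool" where
  "split_cover p Y K \<longleftrightarrow> lifts p Y K \<and> (\<exists>H. is_complement H p Y K)"

definition is_section :: "('v \<Rightarrow> 'v) \<Rightarrow> 'v graph \<Rightarrow> 'v graph \<Rightarrow> 'v set \<Rightarrow> bool" where
  "is_section p Y X S \<longleftrightarrow> S \<subseteq> verts Y \<and> (\<forall>x\<in>verts X. \<exists>!y. y \<in> S \<and> p y = x)"

definition sectional ::
  "('v \<Rightarrow> 'v) set \<Rightarrow> ('v \<Rightarrow> 'v) \<Rightarrow> 'v graph \<Rightarrow> 'v graph \<Rightarrow> bool" where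
  "sectional H p Y X \<longleftrightarrow> (\<exists>S. is_section p Y X S \<and> (\<forall>h\<in>H. h ` S = S))"

definition split_sectional ::
  "('v \<Rightarrow> 'v) \<Rightarrow> 'v graph \<Rightarrow> 'v graph \<Rightarrow> ('v \<Rightarrow> 'v) set \<Rightarrow> bool" where
  "split_sectional p Y X K \<longleftrightarrow> split_cover p Y K \<and>
     (\<forall>H. is_complement H p Y K \<longrightarrow> sectional H p Y X)"

definition split_transitive ::
  "('v \<Rightarrow> 'v) \<Rightarrow> 'v graph \<Rightarrow> 'v graph \<Rightarrow> ('v \<Rightarrow> 'v) set \<Rightarrow> bool" where
  "split_transitive p Y X K \<longleftrightarrow> split_cover p Y K \<and>
     (\<forall>H. is_complement H p Y K \<longrightarrow> vertex_transitive H Y)"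

definition split_mixed ::
  "('v \<Rightarrow> 'v) \<Rightarrow> 'v graph \<Rightarrow> 'v graph \<Rightarrow> ('v \<Rightarrow> 'v) set \<Rightarrow> bool" where
  "split_mixed p Y X K \<longleftrightarrow> split_cover p Y K \<and>
     (\<exists>H. is_complement H p Y K \<and> sectional H p Y X) \<and>
     (\<exists>H. is_complement H p Y K \<and> vertex_transitive H Y)"

definition admissible_2chain ::
  "(nat \<Rightarrow> 'v graph) \<Rightarrow> (nat \<Rightarrow> 'v \<Rightarrow> 'v) \<Rightarrow> (nat \<Rightarrow> ('v \<Rightarrow> 'v) set) \<Rightarrow> nat \<Rightarrow> bool" where
  "admissible_2chain X p G n \<longleftrightarrow>
     (\<forall>j\<in>{1..n}. two_cover (p j) (X j) (X (j - 1)) \<and>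
        lifts (p j) (X j) (G (j - 1)) \<and>
        G j = lifted_group (p j) (X j) (G (j - 1)))"

end

theory Submission
  imports Defs
begin

text \<open>
  Call a homomorphism from \<open>G\<close> to \<open>\<int>/2\<close> a parity. Complements of \<open>CT\<close> in the lifted group are the
  kernels of the parities that do not vanish on the covering transformation \<open>\<tau>\<close>, while the parities
  vanishing on \<open>\<tau>\<close> are exactly the pullbacks of parities of the base group. At most one nontrivial
  parity vanishes on all vertex stabilizers (\<^emph>\<open>even\<close>), and two parities that do not (\<^emph>\<open>odd\<close>) differ by
  an even one. Hence along the chain every split step creates either the first even or the first odd
  parity; so there are at most two split steps. The complement defined by a parity is sectional if
  the parity is even and transitive if it is odd.

  For the last claim let \<open>G\<close> be \<open>s\<close>-regular with an odd parity. Along a line \<open>v\<^sub>i\<close> shifted by an element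
  of \<open>G\<close>, let \<open>x\<^sub>i\<close> be the involution fixing \<open>v\<^sub>i, \<dots>, v\<^sub>i\<^sub>+\<^sub>s\<^sub>-\<^sub>1\<close>. The \<open>x\<^sub>i\<close> are conjugate and generate the
  vertex stabilizers, so all of them are odd. As in Tutte's bound on \<open>s\<close>, one compares the fixed
  segment of the first nontrivial commutator \<open>[x\<^sub>0, x\<^sub>\<kappa>]\<close> with the length \<open>s\<close>. The cases \<open>s = 4\<close> and \<open>s = 7\<close>
  left over by the inequalities would force this commutator to be some odd \<open>x\<^sub>i\<close>.
\<close>

section \<open>Arc-transitive groups of cubic graphs\<close>

text \<open>These are the \<open>m\<close>-arcs, encoded as total functions of which only the values
  at 0, ..., \<open>m\<close> matter. A walk can then be changed by function update or read off a
  line.\<close>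

definition walk :: "'v graph \<Rightarrow> nat \<Rightarrow> (nat \<Rightarrow> 'v) \<Rightarrow> bool" where
  "walk X m f \<longleftrightarrow> (\<forall>i<m. adj X (f i) (f (Suc i))) \<and>
     (\<forall>i. Suc i < m \<longrightarrow> f i \<noteq> f (Suc (Suc i)))"

definition walk_transitive :: "('v \<Rightarrow> 'v) set \<Rightarrow> 'v graph \<Rightarrow> nat \<Rightarrow> bool" where
  "walk_transitive G X m \<longleftrightarrow>
     (\<forall>f f'. walk X m f \<longrightarrow> walk X m f' \<longrightarrow> (\<exists>g\<in>G. \<forall>i\<le>m. g (f i) = f' i))"

text \<open>Together with \<open>walk_transitive\<close> this is \<open>m\<close>-regularity,
  separated into uniqueness and existence.\<close>

definition walk_faithful :: "('v \<Rightarrow> 'v) set \<Rightarrow> 'v graph \<Rightarrow> nat \<Rightarrow> bool" where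
  "walk_faithful G X m \<longleftrightarrow>
     (\<forall>f g. walk X m f \<longrightarrow> g \<in> G \<longrightarrow> (\<forall>i\<le>m. g (f i) = f i) \<longrightarrow> g = id)"

text \<open>\<open>True\<close> stands for the nonzero element of Z/2, so addition is inequality of
  booleans. Values outside \<open>G\<close> are unconstrained.\<close>

definition parity_hom :: "('v \<Rightarrow> 'v) set \<Rightarrow> (('v \<Rightarrow> 'v) \<Rightarrow> bool) \<Rightarrow> bool" where
  "parity_hom G \<chi> \<longleftrightarrow> (\<forall>g\<in>G. \<forall>h\<in>G. \<chi> (g \<circ> h) = (\<chi> g \<noteq> \<chi> h))"

definition even_stabilizers :: "'v graph \<Rightarrow> ('v \<Rightarrow> 'v) set \<Rightarrow> (('v \<Rightarrow> 'v) \<Rightarrow> bool) \<Rightarrow> bool" where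
  "even_stabilizers X G \<chi> \<longleftrightarrow> (\<forall>y\<in>verts X. \<forall>g\<in>G. g y = y \<longrightarrow> \<not> \<chi> g)"

section \<open>Automorphisms as permutations of the whole vertex type\<close>

lemma autD:
  assumes "g \<in> aut X" "simple_graph X"
  shows aut_bij: "bij g"
    and aut_adj: "adj X (g x) (g y) \<longleftrightarrow> adj X x y"
    and aut_verts: "g x \<in> verts X \<longleftrightarrow> x \<in> verts X"
proof -
  have b: "bij_betw g (verts X) (verts X)" and o: "\<And>x. x \<notin> verts X \<Longrightarrow> g x = x"
    and a: "\<And>x y. x \<in> verts X \<Longrightarrow> y \<in> verts X \<Longrightarrow> adj X (g x) (g y) \<longleftrightarrow> adj X x y"
    using assms by (auto simp: aut_def)
  have "bij_betw g (- verts X) (- verts X)"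
    using o by (auto simp: bij_betw_def inj_on_def image_iff)
  from bij_betw_combine[OF b this] show "bij g" by (simp add: Compl_partition)
  show v: "g x \<in> verts X \<longleftrightarrow> x \<in> verts X" for x
    using b o by (metis bij_betwE)
  show "adj X (g x) (g y) \<longleftrightarrow> adj X x y"
    using a v assms(2) unfolding simple_graph_def by metis
qed

lemma autI:
  assumes "bij g" "\<And>x y. adj X (g x) (g y) \<longleftrightarrow> adj X x y" "\<And>x. x \<notin> verts X \<Longrightarrow> g x = x"
    "\<And>x. g x \<in> verts X \<longleftrightarrow> x \<in> verts X"
  shows "g \<in> aut X"
proof -
  have "g ` verts X = verts X"
    using assms(1,4) by (auto simp: image_iff) (metis bij_pointE)
  then have "bij_betw g (verts X) (verts X)"
    using assms(1) by (auto simp: bij_betw_def bij_def intro: inj_on_subset)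
  then show ?thesis using assms by (auto simp: aut_def)
qed

lemma aut_comp:
  assumes "g \<in> aut X" "h \<in> aut X" "simple_graph X"
  shows "g \<circ> h \<in> aut X"
proof (rule autI)
  show "bij (g \<circ> h)" using assms by (auto intro: bij_comp aut_bij)
qed (use assms in \<open>auto simp: autD aut_def\<close>)

lemma aut_inv:
  assumes "g \<in> aut X" "simple_graph X"
  shows "inv g \<in> aut X"
proof (rule autI)
  have b: "bij g" by (rule aut_bij[OF assms])
  then have gi: "g (inv g x) = x" for x by (simp add: bij_is_surj surj_f_inv_f)
  show "bij (inv g)" using b by (rule bij_imp_bij_inv)
  show "adj X (inv g x) (inv g y) \<longleftrightarrow> adj X x y" for x y
    using aut_adj[OF assms, of "inv g x" "inv g y"] gi by simp
  show "inv g x = x" if "x \<notin> verts X" for x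
  proof -
    have "g x = x" using that assms(1) by (simp add: aut_def)
    then show ?thesis using b by (metis bij_inv_eq_iff)
  qed
  show "inv g x \<in> verts X \<longleftrightarrow> x \<in> verts X" for x
    using aut_verts[OF assms, of "inv g x"] gi by simp
qed

lemma aut_id: "id \<in> aut X"
  by (auto simp: aut_def)

locale cubic_arc_group =
  fixes X :: "'v graph" and G :: "('v \<Rightarrow> 'v) set"
  assumes simple: "simple_graph X" and conn: "connected_graph X" and cub: "cubic X"
    and sub: "aut_subgroup G X" and arctr: "arc_transitive G X"
begin

lemma G_aut: "g \<in> G \<Longrightarrow> g \<in> aut X"
  using sub by (auto simp: aut_subgroup_def)

lemma G_id [simp, intro]: "id \<in> G"
  using sub by (auto simp: aut_subgroup_def)

lemma G_comp [intro]: "g \<in> G \<Longrightarrow> h \<in> G \<Longrightarrow> g \<circ> h \<in> G"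
  using sub by (auto simp: aut_subgroup_def)

lemma G_bij: "g \<in> G \<Longrightarrow> bij g"
  using G_aut simple by (rule aut_bij)

lemma G_eq_iff [simp]: "g \<in> G \<Longrightarrow> g x = g y \<longleftrightarrow> x = y"
  using G_bij by (metis bij_pointE)

lemma G_adj [simp]: "g \<in> G \<Longrightarrow> adj X (g x) (g y) \<longleftrightarrow> adj X x y"
  using G_aut simple by (rule aut_adj)

lemma G_verts [simp]: "g \<in> G \<Longrightarrow> g x \<in> verts X \<longleftrightarrow> x \<in> verts X"
  using G_aut simple by (rule aut_verts)

lemma G_inv [intro]: assumes "g \<in> G" shows "inv g \<in> G"
proof -
  obtain g' where g': "g' \<in> G" "g' \<circ> g = id"
    using sub assms by (auto simp: aut_subgroup_def)
  then have "g' = inv g"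
    using G_bij[OF assms] by (metis bij_is_surj comp_assoc comp_id id_comp surj_iff)
  with g' show ?thesis by simp
qed

lemma inv_G [simp]: "g \<in> G \<Longrightarrow> inv g (g x) = x" "g \<in> G \<Longrightarrow> g (inv g x) = x"
  using G_bij by (auto simp: bij_is_inj bij_is_surj surj_f_inv_f)

lemma comp_inv: "g \<in> G \<Longrightarrow> g \<circ> inv g = id"
  by (auto simp: fun_eq_iff)

lemma G_eqI:
  assumes "g \<in> G" "h \<in> G" "\<And>x. x \<in> verts X \<Longrightarrow> g x = h x"
  shows "g = h"
proof
  fix x show "g x = h x"
    using G_aut[OF assms(1)] G_aut[OF assms(2)] assms(3) by (cases "x \<in> verts X") (auto simp: aut_def)
qed

lemma adjD: "adj X x y \<Longrightarrow> x \<in> verts X" "adj X x y \<Longrightarrow> y \<in> verts X"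
  "adj X x y \<Longrightarrow> x \<noteq> y" "adj X x y \<Longrightarrow> adj X y x"
  using simple unfolding simple_graph_def by auto

lemma arc_map: "adj X u v \<Longrightarrow> adj X u' v' \<Longrightarrow> \<exists>g\<in>G. g u = u' \<and> g v = v'"
  using arctr unfolding arc_transitive_def by blast

lemma connected_induct:
  assumes "x \<in> verts X" "y \<in> verts X" "P x" "\<And>u w. u \<in> verts X \<Longrightarrow> P u \<Longrightarrow> adj X u w \<Longrightarrow> P w"
  shows "P y"
proof -
  have "(adj X)\<^sup>*\<^sup>* x y" using conn assms(1,2) by (auto simp: connected_graph_def)
  then have "P y \<and> y \<in> verts X"
  proof (induction rule: rtranclp_induct)
    case base show ?case using assms(1,3) by blast
  next
    case (step u w) then show ?case using assms(4)[of u w] adjD(2)[of u w] by blast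
  qed
  then show ?thesis ..
qed

lemma nbhd_card: "q \<in> verts X \<Longrightarrow> card (nbhd X q) = 3"
  using cub by (auto simp: cubic_def)

lemma third_neighbour:
  assumes "adj X q p" "adj X q r" "p \<noteq> r"
  obtains t where "adj X q t" "t \<noteq> p" "t \<noteq> r" "\<And>u. adj X q u \<Longrightarrow> u = p \<or> u = r \<or> u = t"
proof -
  have c: "card (nbhd X q) = 3" using assms adjD nbhd_card by metis
  then have "card (nbhd X q - {p, r}) = 1"
    using assms by (subst card_Diff_subset) (auto simp: nbhd_def)
  then obtain t where t: "nbhd X q - {p, r} = {t}" by (auto simp: card_1_singleton_iff)
  show ?thesis
  proof (rule that[of t])
    show "u = p \<or> u = r \<or> u = t" if "adj X q u" for u
      using t that by (auto simp: nbhd_def)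
  qed (use t in \<open>auto simp: nbhd_def\<close>)
qed

lemma other_neighbour:
  assumes "adj X q p" obtains r where "adj X q r" "r \<noteq> p"
proof -
  have c: "card (nbhd X q) = 3" using assms adjD nbhd_card by metis
  have "\<not> nbhd X q \<subseteq> {p}"
    using c card_mono[of "{p}" "nbhd X q"] by auto
  then show ?thesis using that by (auto simp: nbhd_def)
qed

lemma ex_vertex: obtains v where "v \<in> verts X"
  using conn by (auto simp: connected_graph_def)

lemma ex_neighbour: assumes "x \<in> verts X" obtains y where "adj X x y"
proof -
  have "nbhd X x \<noteq> {}" using nbhd_card[OF assms] by auto
  then show ?thesis using that by (auto simp: nbhd_def)
qed

lemma vertex_map:
  assumes "x \<in> verts X" "y \<in> verts X" shows "\<exists>g\<in>G. g x = y"
  by (meson assms arc_map ex_neighbour)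

text \<open>An element fixing \<open>q\<close> and \<open>p\<close> permutes the two remaining
  neighbours of \<open>q\<close>, so if it moves one of them it exchanges both.\<close>

lemma swap_back:
  assumes "g \<in> G" "h \<in> G" "adj X q p" "adj X q r" "r \<noteq> p"
    and "g q = q" "g p = p" "h q = q" "h p = p" "g r \<noteq> r" "h r \<noteq> r"
  shows "g (h r) = r"
proof -
  obtain t where t: "adj X q t" "t \<noteq> p" "t \<noteq> r" "\<And>u. adj X q u \<Longrightarrow> u = p \<or> u = r \<or> u = t"
    using third_neighbour[OF assms(3,4)] assms(5) by metis
  have g: "k r = t" if "k \<in> G" "k q = q" "k p = p" "k r \<noteq> r" for k
    using t(4)[of "k r"] that assms(4,5) by (metis G_adj G_eq_iff)
  have "g t \<noteq> t" "g t \<noteq> p" using g[of g] assms t by (metis G_eq_iff)+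
  moreover have "adj X q (g t)" using assms t by (metis G_adj)
  ultimately have "g t = r" using t(4) by blast
  then show ?thesis using g[of h] assms by simp
qed

text \<open>The group fixing \<open>q\<close> and \<open>p\<close> acts on the other two neighbours
  of \<open>q\<close> with order at most two, so squares act trivially. For involutions
  \<open>g\<close> and \<open>h\<close> the square of \<open>g \<circ> h\<close> is their
  commutator.\<close>

lemma commutator_fixes_neighbour:
  assumes "g \<in> G" "h \<in> G" "adj X q p" "adj X q r" "r \<noteq> p"
    and "g q = q" "g p = p" "h q = q" "h p = p"
  shows "g (h (g (h r))) = r"
  using swap_back[of "g \<circ> h" "g \<circ> h" q p r] assms by fastforce

lemma fix_third_neighbour:
  assumes "g \<in> G" "adj X q p" "adj X q r" "r \<noteq> p" "g q = q" "g p = p" "g r = r" "adj X q u"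
  shows "g u = u"
  by (metis assms G_adj G_eq_iff third_neighbour)

section \<open>Parities and vertex stabilizers\<close>

lemma parity_id: "parity_hom G \<chi> \<Longrightarrow> \<not> \<chi> id"
  unfolding parity_hom_def by (metis G_id comp_id)

lemma parity_inv: 
  assumes "parity_hom G \<chi>" "g \<in> G" shows "\<chi> (inv g) = \<chi> g"
proof -
  have "inv g \<circ> g = id" using assms by auto
  then show ?thesis using assms parity_id unfolding parity_hom_def by (metis G_inv)
qed

lemma parity_comp: "parity_hom G \<chi> \<Longrightarrow> g \<in> G \<Longrightarrow> h \<in> G \<Longrightarrow> \<chi> (g \<circ> h) = (\<chi> g \<noteq> \<chi> h)"
  by (auto simp: parity_hom_def)

lemma parity_add:
  "parity_hom G \<chi> \<Longrightarrow> parity_hom G \<psi> \<Longrightarrow> parity_hom G (\<lambda>g. \<chi> g \<noteq> \<psi> g)"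
  by (auto simp: parity_hom_def)

text \<open>Vertex stabilizers are conjugate by vertex-transitivity, and a parity is constant on
  conjugacy classes.\<close>

lemma even_stabilizersI:
  assumes "parity_hom G \<chi>" "y \<in> verts X" "\<And>g. g \<in> G \<Longrightarrow> g y = y \<Longrightarrow> \<not> \<chi> g"
  shows "even_stabilizers X G \<chi>"
  unfolding even_stabilizers_def
proof (intro ballI impI)
  fix w g assume w: "w \<in> verts X" and g: "g \<in> G" "g w = w"
  obtain k where k: "k \<in> G" "k y = w" using vertex_map assms(2) w by blast
  have "\<not> \<chi> (inv k \<circ> (g \<circ> k))" using assms(3) g k by (metis G_comp G_inv comp_apply inv_G(1))
  then show "\<not> \<chi> g"
    using parity_comp[OF assms(1)] parity_inv[OF assms(1)] g k by (metis G_comp G_inv)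
qed

text \<open>With even stabilizers, the parity of an element is determined by the image of a single
  vertex. Conjugates of \<open>f\<close> are even and take any vertex to any chosen neighbour, so by
  connectedness some even element agrees with \<open>g\<close> at \<open>v\<close>.\<close>

lemma even_stabilizers_trivial:
  assumes \<chi>: "parity_hom G \<chi>" and st: "even_stabilizers X G \<chi>"
    and f: "f \<in> G" "adj X v (f v)" "\<not> \<chi> f" and g: "g \<in> G"
  shows "\<not> \<chi> g"
proof -
  have same: "\<chi> h = \<chi> k" if "h \<in> G" "k \<in> G" "h u = k u" "u \<in> verts X" for h k u
  proof -
    have "\<not> \<chi> (inv k \<circ> h)"
      using st that unfolding even_stabilizers_def by (metis G_comp G_inv comp_apply inv_G(1))
    then show ?thesis using parity_comp[OF \<chi>] parity_inv[OF \<chi>] that by (metis G_inv)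
  qed
  have step: "\<exists>h\<in>G. h u = w \<and> \<not> \<chi> h" if uw: "adj X u w" for u w
  proof -
    obtain k where k: "k \<in> G" "k v = u" "k (f v) = w" using arc_map[OF f(2) uw] by auto
    have "(k \<circ> f \<circ> inv k) u = w" using k by auto
    moreover have "\<not> \<chi> (k \<circ> f \<circ> inv k)"
      using parity_comp[OF \<chi>] parity_inv[OF \<chi>] k f by (metis G_comp G_inv)
    ultimately show ?thesis using k f by (metis G_comp G_inv)
  qed
  have v: "v \<in> verts X" using f adjD by blast
  have "\<exists>h\<in>G. h v = g v \<and> \<not> \<chi> h"
  proof (rule connected_induct[where P = "\<lambda>w. \<exists>h\<in>G. h v = w \<and> \<not> \<chi> h", OF v])
    show "\<exists>h\<in>G. h v = v \<and> \<not> \<chi> h" using parity_id[OF \<chi>] G_id by (metis id_apply)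
    fix u w assume "\<exists>h\<in>G. h v = u \<and> \<not> \<chi> h" "adj X u w"
    then show "\<exists>h\<in>G. h v = w \<and> \<not> \<chi> h"
      using step parity_comp[OF \<chi>] by (metis G_comp comp_apply)
  qed (use v g in auto)
  then show ?thesis using same g v by metis
qed

text \<open>An element taking a vertex to a neighbour must be odd for both parities by
  \<open>even_stabilizers_trivial\<close>. It is therefore even for their sum, whose stabilizers are
  even as well, and so the sum vanishes.\<close>

lemma even_stabilizers_unique:
  assumes "parity_hom G \<chi>" "even_stabilizers X G \<chi>" "\<exists>g\<in>G. \<chi> g"
    and "parity_hom G \<psi>" "even_stabilizers X G \<psi>" "\<exists>g\<in>G. \<psi> g" and "g \<in> G"
  shows "\<chi> g = \<psi> g"
proof -
  obtain u w where uw: "adj X u w" by (meson ex_vertex ex_neighbour)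
  then obtain f where f: "f \<in> G" "f u = w" using arc_map adjD(4) by blast
  have "\<chi> f" "\<psi> f" using even_stabilizers_trivial[of _ f u] assms f uw by blast+
  moreover have "even_stabilizers X G (\<lambda>g. \<chi> g \<noteq> \<psi> g)"
    using assms by (auto simp: even_stabilizers_def)
  ultimately show ?thesis
    using even_stabilizers_trivial[OF parity_add[OF assms(1,4)], of f u g] f uw assms(7) by auto
qed

section \<open>From maximal transitivity on walks to regularity\<close>

lemma walk_transitive_1: "walk_transitive G X 1"
  unfolding walk_transitive_def
proof (intro allI impI)
  fix f f' assume "walk X 1 f" "walk X 1 f'"
  then obtain g where "g \<in> G" "g (f 0) = f' 0" "g (f 1) = f' 1"
    using arc_map[of "f 0" "f 1" "f' 0" "f' 1"] by (auto simp: walk_def)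
  then show "\<exists>g\<in>G. \<forall>i\<le>1. g (f i) = f' i" by (metis One_nat_def le_Suc_eq le_zero_eq)
qed

text \<open>An element sending an arc to one that continues it is iterated in both directions. As
  the graph is finite the line closes up, so integers are positions along it and not names of
  distinct vertices.\<close>

lemma ex_shunt:
  obtains a v where "a \<in> G" "\<And>i::int. a (v i) = v (i + 1)" "\<And>i. adj X (v i) (v (i + 1))"
    "\<And>i. v i \<noteq> v (i + 2)"
proof -
  obtain u w where uw: "adj X u w" by (meson ex_vertex ex_neighbour)
  obtain z where z: "adj X w z" "z \<noteq> u" using other_neighbour[OF adjD(4)[OF uw]] by metis
  obtain a where a: "a \<in> G" "a u = w" "a w = z" using arc_map[OF uw z(1)] by auto
  define v where "v i = (if 0 \<le> i then (a ^^ nat i) u else (inv a ^^ nat (- i)) u)" for i :: int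
  have sh: "a (v i) = v (i + 1)" for i
  proof (cases "0 \<le> i")
    case True
    then show ?thesis by (simp add: v_def nat_add_distrib)
  next
    case False
    then obtain k where k: "i = - int (Suc k)" by (cases i) auto
    then have "nat (- i) = Suc k" "i + 1 = - int k" by simp_all
    then show ?thesis using False a(1) k by (auto simp: v_def)
  qed
  have ind: "P i" if "P 0" "\<And>i. P i = P (i + 1)" for P and i :: int
    by (induction i rule: int_induct[where k = 0]) (use that in \<open>metis diff_add_cancel\<close>)+
  have v012: "v 0 = u" "v 1 = w" "v 2 = z"
    using a sh[of 0] sh[of 1] by (auto simp: v_def)
  have "adj X (v i) (v (i + 1))" for i
  proof (rule ind[where P = "\<lambda>i. adj X (v i) (v (i + 1))"])
    show "adj X (v 0) (v (0 + 1))" using v012 uw by simp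
    show "adj X (v i) (v (i + 1)) = adj X (v (i + 1)) (v (i + 1 + 1))" for i
      using G_adj[OF a(1), of "v i" "v (i + 1)"] by (simp add: sh)
  qed
  moreover have "v i \<noteq> v (i + 2)" for i
  proof (rule ind[where P = "\<lambda>i. v i \<noteq> v (i + 2)"])
    show "v 0 \<noteq> v (0 + 2)" using v012 z by auto
    show "(v i \<noteq> v (i + 2)) = (v (i + 1) \<noteq> v (i + 1 + 2))" for i
      using G_eq_iff[OF a(1), of "v i" "v (i + 2)"] by (simp add: sh ac_simps)
  qed
  ultimately show ?thesis using that a(1) sh by blast
qed

lemma walk_of_line:
  assumes "\<And>i::int. adj X (v i) (v (i + 1))" "\<And>i. v i \<noteq> v (i + 2)"
  shows "walk X m (\<lambda>k. v (i + int k))"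
  unfolding walk_def using assms(1)[of "i + int _"] assms(2)[of "i + int _"] by (simp add: ac_simps)

text \<open>The line returns to its start after some \<open>n\<close> steps. No element can carry
  this closed walk to the walk that differs from it in the last vertex only.\<close>

lemma ex_not_walk_transitive: "\<exists>m\<ge>1. \<not> walk_transitive G X m"
proof -
  obtain a v where a: "a \<in> G" "\<And>i::int. a (v i) = v (i + 1)" "\<And>i. adj X (v i) (v (i + 1))"
    "\<And>i. v i \<noteq> v (i + 2)" by (rule ex_shunt) auto
  have p: "(a ^^ n) (v 0) = v (int n)" for n by (induction n) (auto simp: a ac_simps)
  have "finite {y. \<exists>n. y = (a ^^ n) (v 0)}"
    using simple adjD(1)[OF a(3)] by (auto simp: p simple_graph_def intro: finite_subset)
  then obtain n where n: "n > 0" "(a ^^ n) (v 0) = v 0"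
    using funpow_inj_finite[OF bij_is_inj[OF G_bij[OF a(1)]]] by metis
  then have vn: "v (int n) = v 0" using p by simp
  have "n \<noteq> 1" "n \<noteq> 2" using vn a(3)[of 0] adjD(3) a(4)[of 0] by (auto dest: adjD(3))
  then obtain m where m: "n = Suc (Suc m)" "m > 0" using n by (metis One_nat_def Suc_1 gr0_conv_Suc not0_implies_Suc)
  obtain t where t: "adj X (v (int m + 1)) t" "t \<noteq> v (int m)" "t \<noteq> v (int m + 2)"
    using third_neighbour[of "v (int m + 1)" "v (int m)" "v (int m + 2)"] a(3)[of "int m"]
      a(3)[of "int m + 1"] a(4)[of "int m"] adjD(4) by (metis add.assoc one_add_one)
  define f where "f k = v (int k)" for k
  have w: "walk X n f" using walk_of_line[OF a(3,4), where i = 0] by (simp add: f_def[abs_def])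
  have w': "walk X n (f(n := t))"
    using w t m unfolding walk_def by (auto simp: f_def add.commute)
  show ?thesis
  proof (intro exI[of _ n] conjI notI)
    show "1 \<le> n" using n by simp
    assume "walk_transitive G X n"
    then obtain g where "g \<in> G" "\<forall>i\<le>n. g (f i) = (f(n := t)) i"
      using w w' unfolding walk_transitive_def by blast
    then have "g (f 0) = f 0" "g (f n) = t" using n(1) by auto
    then show False using vn t m by (simp add: f_def add.commute)
  qed
qed

lemma walk_rev: "walk X m f \<Longrightarrow> walk X m (\<lambda>i. f (m - i))"
  unfolding walk_def
proof (intro conjI allI impI; elim conjE)
  fix i assume *: "\<forall>i<m. adj X (f i) (f (Suc i))" "i < m"
  then have "adj X (f (m - Suc i)) (f (Suc (m - Suc i)))" by simp
  then show "adj X (f (m - i)) (f (m - Suc i))" using * adjD(4) by (simp add: Suc_diff_Suc)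
next
  fix i assume *: "\<forall>i. Suc i < m \<longrightarrow> f i \<noteq> f (Suc (Suc i))" "Suc i < m"
  then have "f (m - Suc (Suc i)) \<noteq> f (Suc (Suc (m - Suc (Suc i))))" by simp
  then show "f (m - i) \<noteq> f (m - Suc (Suc i))" using * by (simp add: Suc_diff_Suc)
qed

text \<open>Let \<open>s + 1\<close> be the first length at which transitivity fails. If the
  pointwise stabilizer of an \<open>s\<close>-walk could still move the next vertex, transitivity
  would hold at that length too. So it fixes all neighbours of the end, and this spreads over the
  graph.\<close>

lemma ex_walk_regular:
  obtains s where "s \<ge> 1" "walk_transitive G X s" "walk_faithful G X s"
proof -
  define N where "N = (LEAST m. m \<ge> 1 \<and> \<not> walk_transitive G X m)"
  have N: "N \<ge> 1" "\<not> walk_transitive G X N"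
    using LeastI_ex[of "\<lambda>m. m \<ge> 1 \<and> \<not> walk_transitive G X m"] ex_not_walk_transitive
    unfolding N_def by blast+
  moreover have "N \<noteq> 1" using N walk_transitive_1 by auto
  ultimately obtain s where s: "N = Suc s" "s \<ge> 1"
    by (metis One_nat_def Suc_le_eq gr0_conv_Suc le_neq_implies_less less_Suc_eq_le)
  have tr: "walk_transitive G X s"
    using not_less_Least[of s "\<lambda>m. m \<ge> 1 \<and> \<not> walk_transitive G X m"] s unfolding N_def by auto
  obtain f f' where f: "walk X (Suc s) f" "walk X (Suc s) f'"
    "\<And>g. g \<in> G \<Longrightarrow> \<exists>i\<le>Suc s. g (f i) \<noteq> f' i"
    using N(2) unfolding s walk_transitive_def by blast
  have sub: "walk X s e" if "walk X (Suc s) e" for e using that by (auto simp: walk_def)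
  obtain g where g: "g \<in> G" "\<And>i. i \<le> s \<Longrightarrow> g (f i) = f' i"
    using tr sub[OF f(1)] sub[OF f(2)] unfolding walk_transitive_def by blast
  have ends: "adj X (e s) (e (s - 1))" "adj X (e s) (e (Suc s))" "e (Suc s) \<noteq> e (s - 1)"
    if "walk X (Suc s) e" for e
  proof -
    obtain r where r: "s = Suc r" using s by (cases s) auto
    show "adj X (e s) (e (s - 1))" "adj X (e s) (e (Suc s))" "e (Suc s) \<noteq> e (s - 1)"
      using that adjD(4) unfolding walk_def r by (auto dest: adjD(4))
  qed
  \<comment> \<open>Otherwise \<open>h\<close> exchanges the two possible continuations of
    \<open>f\<close>; since \<open>g\<close> does not carry \<open>f\<close> to \<open>f'\<close>,
    the product \<open>g \<circ> h\<close> would.\<close>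
  have fixf: "h (f (Suc s)) = f (Suc s)" if h: "h \<in> G" "\<And>i. i \<le> s \<Longrightarrow> h (f i) = f i" for h
  proof (rule ccontr)
    assume n: "h (f (Suc s)) \<noteq> f (Suc s)"
    have gs: "g (f (Suc s)) \<noteq> f' (Suc s)" using f(3)[OF g(1)] g(2) le_Suc_eq by blast
    obtain t where t: "\<And>u. adj X (f s) u \<Longrightarrow> u = f (s - 1) \<or> u = f (Suc s) \<or> u = t"
      using third_neighbour[OF ends(1,2)[OF f(1)]] ends(3)[OF f(1)] by metis
    have adjs: "adj X (f s) (inv g (f' (Suc s)))"
      using ends(2)[OF f(2)] g by (metis G_adj G_inv inv_G(1) le_refl)
    have "inv g (f' (Suc s)) \<noteq> f (s - 1)"
      using ends(3)[OF f(2)] g by (metis inv_G(2) diff_le_self)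
    moreover have "inv g (f' (Suc s)) \<noteq> f (Suc s)" using gs g by (metis inv_G(2))
    ultimately have 1: "inv g (f' (Suc s)) = t" using t adjs by blast
    have "adj X (f s) (h (f (Suc s)))" using ends(2)[OF f(1)] h by (metis G_adj le_refl)
    moreover have "h (f (Suc s)) \<noteq> f (s - 1)"
      using ends(3)[OF f(1)] h by (metis G_eq_iff diff_le_self)
    ultimately have "h (f (Suc s)) = t" using t n by blast
    then have "(g \<circ> h) (f (Suc s)) = f' (Suc s)" using 1 g(1) by (metis comp_apply inv_G(2))
    moreover have "(g \<circ> h) (f i) = f' i" if "i \<le> s" for i using that g h by simp
    ultimately show False using f(3)[of "g \<circ> h"] g h by (metis G_comp le_Suc_eq)
  qed
  have ext: "h u = u"
    if e: "walk X s e" and h: "h \<in> G" "\<And>i. i \<le> s \<Longrightarrow> h (e i) = e i" and u: "adj X (e s) u" for e h u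
  proof -
    obtain k where k: "k \<in> G" "\<And>i. i \<le> s \<Longrightarrow> k (f i) = e i"
      using tr sub[OF f(1)] e unfolding walk_transitive_def by blast
    let ?h = "inv k \<circ> (h \<circ> k)"
    have "?h \<in> G" using k h by blast
    moreover have fx: "?h (f i) = f i" if "i \<le> s" for i using that k h by (metis comp_apply inv_G(1))
    ultimately have "?h w = w" if "adj X (f s) w" for w
      using fix_third_neighbour[OF _ ends[OF f(1)], of ?h w] fixf[of ?h] that by simp
    moreover have "adj X (f s) (inv k u)" using u k by (metis G_adj G_inv inv_G(1) le_refl)
    ultimately have "?h (inv k u) = inv k u" by blast
    then show ?thesis using k h by (metis G_inv G_eq_iff comp_apply inv_G(2))
  qed
  have "h = id" if e: "walk X s e" and h: "h \<in> G" "\<And>i. i \<le> s \<Longrightarrow> h (e i) = e i" for e h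
  proof (rule G_eqI[OF h(1) G_id])
    \<comment> \<open>\<open>?P w\<close> says that \<open>w\<close> is the end of an
      \<open>s\<close>-walk fixed pointwise by \<open>h\<close>. Such walks are pushed along edges
      until they end at \<open>y\<close>.\<close>
    let ?P = "\<lambda>w. \<exists>e. walk X s e \<and> (\<forall>i\<le>s. h (e i) = e i) \<and> e s = w"
    obtain r where r: "s = Suc r" using s by (cases s) auto
    fix y assume y: "y \<in> verts X"
    have "?P y"
    proof (rule connected_induct[where x = "e s"])
      show "e s \<in> verts X" using e adjD(2) unfolding walk_def r by blast
      show "?P (e s)" using e h by blast
      fix u w assume "?P u" and uw: "adj X u w"
      then obtain d where d: "walk X s d" "\<And>i. i \<le> s \<Longrightarrow> h (d i) = d i" "d s = u" by blast
      show "?P w"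
      proof (cases "w = d r")
        case False
        have "h w = w" using ext[OF d(1) h(1) d(2)] d(3) uw by blast
        then show ?thesis using d uw False unfolding walk_def r
          by (intro exI[of _ "\<lambda>i. if i = Suc r then w else d (Suc i)"]) (auto simp: less_Suc_eq_le)
      next
        \<comment> \<open>Here the walk steps back to its last but one vertex: it loses its end and
          gains a vertex \<open>t\<close> at its start, where the reversed walk shows that all
          neighbours are fixed.\<close>
        case True
        have "adj X (d 0) (d 1)" using d(1) by (auto simp: walk_def r)
        then obtain t where t: "adj X (d 0) t" "t \<noteq> d 1" using other_neighbour by metis
        have "h t = t" using ext[OF walk_rev[OF d(1)] h(1), of t] d(2) t by simp
        then show ?thesis using d t True unfolding walk_def r
          by (intro exI[of _ "case_nat t d"]) (auto simp: adjD(4) split: nat.split)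
      qed
    qed (use y in auto)
    then show "h y = id y" by auto
  qed
  then have "walk_faithful G X s" unfolding walk_faithful_def by blast
  with s tr that show ?thesis by blast
qed

lemma ex_walk: "\<exists>f. walk X m f"
  by (rule ex_shunt) (use walk_of_line in blast)

lemma s_regular_of_walk_regular:
  assumes "walk_transitive G X s" "walk_faithful G X s"
  shows "s_regular G X s"
proof -
  have arc: "s_arc X s xs \<longleftrightarrow> length xs = Suc s \<and> walk X s ((!) xs)" for xs
  proof -
    have "(\<forall>i. 0 < i \<and> i < s \<longrightarrow> xs ! (i - 1) \<noteq> xs ! Suc i) \<longleftrightarrow>
      (\<forall>i. Suc i < s \<longrightarrow> xs ! i \<noteq> xs ! Suc (Suc i))"
      by (metis Suc_pred' diff_Suc_1 zero_less_Suc)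
    then show ?thesis by (simp add: s_arc_def walk_def)
  qed
  obtain f where f: "walk X s f" using ex_walk by blast
  have "s_arc X s (map f [0..<Suc s])" unfolding arc using f
    by (auto simp: walk_def nth_append simp del: upt_Suc)
  moreover have "\<exists>!g. g \<in> G \<and> map g xs = ys" if "s_arc X s xs" "s_arc X s ys" for xs ys
  proof -
    have l: "length xs = Suc s" "length ys = Suc s" and w: "walk X s ((!) xs)" "walk X s ((!) ys)"
      using that arc by auto
    have m: "map g xs = ys \<longleftrightarrow> (\<forall>i\<le>s. g (xs ! i) = ys ! i)" for g
      using l by (auto simp: list_eq_iff_nth_eq less_Suc_eq_le)
    obtain g where g: "g \<in> G" "\<forall>i\<le>s. g (xs ! i) = ys ! i"
      using assms(1) w unfolding walk_transitive_def by blast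
    show ?thesis unfolding m
    proof (rule ex1I[of _ g])
      fix h assume h: "h \<in> G \<and> (\<forall>i\<le>s. h (xs ! i) = ys ! i)"
      then have "\<forall>i\<le>s. (inv g \<circ> h) (xs ! i) = xs ! i" using g by (metis comp_apply inv_G(1))
      then have "inv g \<circ> h = id"
        using assms(2) w(1) g(1) h unfolding walk_faithful_def by (metis G_comp G_inv)
      then show "h = g" using g(1) by (metis comp_apply id_apply inv_G(2) ext)
    qed (use g in auto)
  qed
  ultimately show ?thesis unfolding s_regular_def by blast
qed

end

section \<open>Vertex stabilizers of s-regular groups\<close>

locale shunted_group = cubic_arc_group X G for X :: "'v graph" and G +
  fixes s :: nat and a :: "'v \<Rightarrow> 'v" and v :: "int \<Rightarrow> 'v"
  assumes s_ge_2: "2 \<le> s"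
    and trans: "walk_transitive G X s" and faithful: "walk_faithful G X s"
    and a_G: "a \<in> G" and a_v: "a (v i) = v (i + 1)"
    and v_adj: "adj X (v i) (v (i + 1))" and v_neq: "v i \<noteq> v (i + 2)"
begin

section \<open>Segment stabilizers and the involutions \<open>x i\<close>\<close>

definition S :: "int \<Rightarrow> int \<Rightarrow> ('v \<Rightarrow> 'v) set" where
  "S i j = {g \<in> G. \<forall>k. i \<le> k \<and> k \<le> j \<longrightarrow> g (v k) = v k}"

lemma S_G: "g \<in> S i j \<Longrightarrow> g \<in> G"
  by (simp add: S_def)

lemma S_fix: "g \<in> S i j \<Longrightarrow> i \<le> k \<Longrightarrow> k \<le> j \<Longrightarrow> g (v k) = v k"
  by (simp add: S_def)

lemma S_mono: "g \<in> S i j \<Longrightarrow> i \<le> i' \<Longrightarrow> j' \<le> j \<Longrightarrow> g \<in> S i' j'"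
  by (auto simp: S_def)

lemma S_comp: "g \<in> S i j \<Longrightarrow> h \<in> S i j \<Longrightarrow> g \<circ> h \<in> S i j"
  by (auto simp: S_def)

lemma S_extend_right: "g \<in> S i j \<Longrightarrow> g (v (j + 1)) = v (j + 1) \<Longrightarrow> g \<in> S i (j + 1)"
  unfolding S_def by (smt (verit) mem_Collect_eq)

lemma S_extend_left: "g \<in> S i j \<Longrightarrow> g (v (i - 1)) = v (i - 1) \<Longrightarrow> g \<in> S (i - 1) j"
  unfolding S_def by (smt (verit) mem_Collect_eq)

lemma v_adj': "adj X (v i) (v (i - 1))" "v (i + 1) \<noteq> v (i - 1)"
  using v_adj[of "i - 1"] v_neq[of "i - 1"] adjD(4) by (auto simp: add.commute)

lemma S_trivial: assumes "g \<in> S i j" "i + int s \<le> j" shows "g = id"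
proof -
  have "walk X s (\<lambda>k. v (i + int k))" by (rule walk_of_line[OF v_adj v_neq])
  moreover have "\<forall>k\<le>s. g (v (i + int k)) = v (i + int k)" using assms by (auto simp: S_def)
  ultimately show ?thesis using faithful S_G[OF assms(1)] unfolding walk_faithful_def by blast
qed

lemma S_swap_right:
  assumes "g \<in> S i j" "h \<in> S i j" "i < j" "g (v (j + 1)) \<noteq> v (j + 1)" "h (v (j + 1)) \<noteq> v (j + 1)"
  shows "g \<circ> h \<in> S i (j + 1)"
proof (rule S_extend_right)
  show "g \<circ> h \<in> S i j" using assms S_comp by blast
  show "(g \<circ> h) (v (j + 1)) = v (j + 1)"
    using swap_back[OF S_G[OF assms(1)] S_G[OF assms(2)] v_adj'(1)[of j] v_adj v_adj'(2)] assms S_fix by simp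
qed

text \<open>The stabilizer of \<open>s\<close> consecutive vertices of the line has order two, so
  the choice is unique, as \<open>S_x\<close> shows.\<close>

definition x :: "int \<Rightarrow> 'v \<Rightarrow> 'v" where
  "x i = (SOME g. g \<in> S i (i + int s - 1) \<and> g (v (i + int s)) \<noteq> v (i + int s))"

lemma x_S: "x i \<in> S i (i + int s - 1)" and x_moves_right: "x i (v (i + int s)) \<noteq> v (i + int s)"
proof -
  let ?f = "\<lambda>k. v (i + int k)"
  have w: "walk X s ?f" by (rule walk_of_line[OF v_adj v_neq])
  obtain r where r: "s = Suc (Suc r)" using s_ge_2 by (metis add_2_eq_Suc le_Suc_ex)
  let ?j = "i + int s - 1"
  obtain t where t: "adj X (v ?j) t" "t \<noteq> v (?j - 1)" "t \<noteq> v (?j + 1)"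
    using third_neighbour[OF v_adj'(1)[of ?j] v_adj[of ?j]] v_adj'(2)[of ?j] by metis
  \<comment> \<open>An element carrying the segment to the walk that differs only in its last vertex
    has the properties required of \<open>x i\<close>.\<close>
  have "walk X s (?f(s := t))"
    using w t unfolding walk_def r by (auto simp: algebra_simps less_Suc_eq)
  then obtain g where g: "g \<in> G" "\<forall>k\<le>s. g (?f k) = (?f(s := t)) k"
    using trans w unfolding walk_transitive_def by blast
  have "g \<in> S i ?j" unfolding S_def
  proof (intro CollectI conjI allI impI g(1))
    fix k assume "i \<le> k \<and> k \<le> ?j"
    then show "g (v k) = v k" using g(2)[rule_format, of "nat (k - i)"] by auto
  qed
  moreover have "g (v (i + int s)) \<noteq> v (i + int s)" using g(2)[rule_format, of s] t by (simp add: algebra_simps)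
  ultimately have "x i \<in> S i ?j \<and> x i (v (i + int s)) \<noteq> v (i + int s)"
    unfolding x_def by (rule someI[of "\<lambda>g. g \<in> S i ?j \<and> g (v (i + int s)) \<noteq> v (i + int s)", OF conjI])
  then show "x i \<in> S i (i + int s - 1)" "x i (v (i + int s)) \<noteq> v (i + int s)" by auto
qed

lemma x_G [simp, intro]: "x i \<in> G"
  using x_S S_G by blast

lemma x_fix: "i \<le> k \<Longrightarrow> k < i + int s \<Longrightarrow> x i (v k) = v k"
  using S_fix[OF x_S] by simp

lemma x_neq_id: "x i \<noteq> id"
  using x_moves_right[of i] by auto

lemma x_moves_left: "x i (v (i - 1)) \<noteq> v (i - 1)"
  using S_extend_left[OF x_S] S_trivial[of "x i" "i - 1" "i + int s - 1"] x_neq_id by auto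

lemma x_involution: "x i \<circ> x i = id"
  and S_x: "g \<in> S i (i + int s - 1) \<Longrightarrow> g \<noteq> id \<Longrightarrow> g = x i"
proof -
  have id: "h \<circ> x i = id" if "h \<in> S i (i + int s - 1)" "h \<noteq> id" for h
  proof -
    have "h (v (i + int s)) \<noteq> v (i + int s)"
      using S_extend_right[OF that(1)] S_trivial[of h i "i + int s"] that(2) by auto
    then have "h \<circ> x i \<in> S i (i + int s - 1 + 1)"
      using S_swap_right[OF that(1) x_S] x_moves_right s_ge_2 by simp
    then show ?thesis using S_trivial by simp
  qed
  show 1: "x i \<circ> x i = id" using id x_S x_neq_id by blast
  show "g = x i" if "g \<in> S i (i + int s - 1)" "g \<noteq> id"
    using id[OF that] 1 by (metis comp_assoc comp_id id_comp)
qed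

lemma x_x [simp]: "x i (x i y) = y"
  using x_involution by (metis comp_apply id_apply)

text \<open>The conjugate of \<open>x i\<close> by \<open>a\<close> fixes the shifted segment and is
  nontrivial, so uniqueness identifies it. All the \<open>x i\<close> are thus conjugate in
  \<open>G\<close>.\<close>

lemma x_shift: "a \<circ> x i = x (i + 1) \<circ> a"
proof -
  let ?g = "a \<circ> x i \<circ> inv a"
  have ai: "inv a (v k) = v (k - 1)" for k using a_v[of "k - 1"] a_G by (metis diff_add_cancel inv_G(1))
  have "?g \<in> S (i + 1) (i + 1 + int s - 1)"
    using a_G x_fix by (auto simp: S_def ai a_v)
  moreover have "?g \<noteq> id"
  proof
    assume "?g = id"
    then have "a (x i y) = a y" for y using a_G by (metis comp_apply id_apply inv_G(1))
    then have "x i = id" using a_G by auto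
    then show False using x_neq_id by simp
  qed
  ultimately have "?g = x (i + 1)" by (rule S_x)
  then show ?thesis using a_G by (auto simp: fun_eq_iff) (metis inv_G(1))
qed

lemma shift_invariant:
  assumes "\<And>i. P i \<longleftrightarrow> P (i + 1 :: int)" shows "P i \<longleftrightarrow> P j"
proof -
  have "P i \<longleftrightarrow> P 0" for i
    by (induction i rule: int_induct[where k = 0]) (use assms in \<open>metis diff_add_cancel\<close>)+
  then show ?thesis by blast
qed

lemma S_generated:
  assumes "P id" "\<And>g h. P g \<Longrightarrow> P h \<Longrightarrow> P (g \<circ> h)"
    and "\<And>k. j - int s < k \<Longrightarrow> k \<le> i \<Longrightarrow> P (x k)" and "i < j" "g \<in> S i j"
  shows "P g"
  using assms(3-)
proof (induction "nat (i + int s - j)" arbitrary: g j)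
  case 0
  then show ?case using S_trivial[of g i j] assms(1) by (metis diff_gt_0_iff_gt linorder_not_le zero_less_nat_eq less_irrefl)
next
  case (Suc n)
  have IH: "P h" if "h \<in> S i (j + 1)" for h
    by (rule Suc.hyps(1)[of "j + 1"]) (use Suc that in auto)
  show ?case
  proof (cases "g (v (j + 1)) = v (j + 1)")
    case True
    then show ?thesis using IH S_extend_right Suc.prems by blast
  next
    case False
    let ?k = "j - int s + 1"
    have "x ?k \<in> S i j" using x_S[of ?k] Suc.hyps(2) by (intro S_mono[OF x_S]) auto
    moreover have "x ?k (v (j + 1)) \<noteq> v (j + 1)" using x_moves_right[of ?k] by (simp add: algebra_simps)
    ultimately have "P (x ?k \<circ> g)" using S_swap_right False Suc.prems IH by blast
    moreover have "P (x ?k)" using Suc by auto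
    ultimately have "P (x ?k \<circ> (x ?k \<circ> g))" using assms(2) by blast
    then show ?thesis by (simp add: x_involution flip: comp_assoc)
  qed
qed

text \<open>On the three neighbours of \<open>v i\<close>, the elements \<open>?A\<close> and
  \<open>?B\<close> act as two different transpositions. Composing \<open>g\<close> with them brings
  the image of \<open>v (i + 1)\<close> back, and what remains is covered by
  \<open>S_generated\<close>.\<close>

lemma stabilizer_generated:
  assumes P: "P id" "\<And>g h. P g \<Longrightarrow> P h \<Longrightarrow> P (g \<circ> h)"
    and Px: "\<And>k. i - int s < k \<Longrightarrow> k \<le> i \<Longrightarrow> P (x k)" and g: "g \<in> G" "g (v i) = v i"
  shows "P g"
proof -
  let ?A = "x (i + 1 - int s)" and ?B = "x i"
  have fixed: "P h" if "h \<in> G" "h (v i) = v i" "h (v (i + 1)) = v (i + 1)" for h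
  proof -
    have "h \<in> S i (i + 1)" using that unfolding S_def by (smt (verit) mem_Collect_eq)
    then show ?thesis using S_generated[where P = P and i = i and j = "i + 1"] P Px by simp
  qed
  have A: "?A (v i) = v i" "?A (v (i - 1)) = v (i - 1)" "?A (v (i + 1)) \<noteq> v (i + 1)"
    using x_fix[of "i + 1 - int s"] x_moves_right[of "i + 1 - int s"] s_ge_2 by (auto simp: algebra_simps)
  have B: "?B (v i) = v i" "?B (v (i + 1)) = v (i + 1)" "?B (v (i - 1)) \<noteq> v (i - 1)"
    using x_fix[of i] x_moves_left[of i] s_ge_2 by auto
  have PA: "P ?A" and PB: "P ?B" using Px s_ge_2 by auto
  obtain t where t: "\<And>u. adj X (v i) u \<Longrightarrow> u = v (i - 1) \<or> u = v (i + 1) \<or> u = t"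
    using third_neighbour[OF v_adj'(1)[of i] v_adj[of i]] v_adj'(2)[of i] by metis
  have At: "?A (v (i + 1)) = t"
    using t[of "?A (v (i + 1))"] A v_adj[of i] v_adj'(2)[of i] by (metis G_adj G_eq_iff x_G)
  have Bt: "?B (v (i - 1)) = t"
    using t[of "?B (v (i - 1))"] B v_adj'(1)[of i] v_adj'(2)[of i] by (metis G_adj G_eq_iff x_G)
  have At': "?A t = v (i + 1)" using At x_x by metis
  have t_case: "P h" if "h \<in> G" "h (v i) = v i" "h (v (i + 1)) = t" for h
  proof -
    have "P (?A \<circ> h)" using fixed[of "?A \<circ> h"] that A At' by auto
    then have "P (?A \<circ> (?A \<circ> h))" using P PA by blast
    then show ?thesis by (simp add: x_involution flip: comp_assoc)
  qed
  have "g (v (i + 1)) = v (i - 1) \<or> g (v (i + 1)) = v (i + 1) \<or> g (v (i + 1)) = t"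
    using t[of "g (v (i + 1))"] g v_adj[of i] by (metis G_adj)
  then show ?thesis
  proof (elim disjE)
    assume "g (v (i + 1)) = v (i - 1)"
    then have "P (?B \<circ> g)" using t_case[of "?B \<circ> g"] g B Bt by auto
    then have "P (?B \<circ> (?B \<circ> g))" using P PB by blast
    then show ?thesis by (simp add: x_involution flip: comp_assoc)
  qed (use fixed t_case g in auto)
qed

section \<open>Commuting and noncommuting generators\<close>

abbreviation comm :: "('v \<Rightarrow> 'v) \<Rightarrow> ('v \<Rightarrow> 'v) \<Rightarrow> bool" where
  "comm g h \<equiv> g \<circ> h = h \<circ> g"

lemma comm_id: "comm g id" and comm_comp: "comm g h \<Longrightarrow> comm g k \<Longrightarrow> comm g (h \<circ> k)"
  by (simp, metis comp_assoc)

lemma comm_S: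
  assumes "\<And>k. j - int s < k \<Longrightarrow> k \<le> i \<Longrightarrow> comm y (x k)" "i < j" "g \<in> S i j"
  shows "comm y g"
  by (rule S_generated[where P = "comm y"]) (use assms comm_id comm_comp in auto)

text \<open>Conjugation by \<open>a\<close> raises both indices by one, so only their difference
  matters.\<close>

lemma comm_x_shift: "comm (x i) (x j) \<longleftrightarrow> comm (x 0) (x (j - i))"
proof -
  have step: "comm (x i) (x j) \<longleftrightarrow> comm (x (i + 1)) (x (j + 1))" for i j
  proof -
    have sh: "x (i + 1) (a y) = a (x i y)" for i y using x_shift by (metis comp_apply)
    have surj: "\<exists>z. y = a z" for y using a_G by (metis inv_G(2))
    have "comm (x (i + 1)) (x (j + 1)) \<longleftrightarrow> (\<forall>z. x (i + 1) (x (j + 1) (a z)) = x (j + 1) (x (i + 1) (a z)))"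
      unfolding fun_eq_iff using surj by (metis comp_apply)
    then show ?thesis using a_G by (simp add: sh fun_eq_iff)
  qed
  have "comm (x i) (x (i + (j - i))) \<longleftrightarrow> comm (x 0) (x (0 + (j - i)))"
  proof (rule shift_invariant[where P = "\<lambda>k. comm (x k) (x (k + (j - i)))"])
    fix k
    have "k + (j - i) + 1 = k + 1 + (j - i)" by simp
    then show "comm (x k) (x (k + (j - i))) \<longleftrightarrow> comm (x (k + 1)) (x (k + 1 + (j - i)))"
      using step[of k "k + (j - i)"] by (simp only:)
  qed
  then show ?thesis by simp
qed

text \<open>Being central in the stabilizers of two adjacent vertices propagates along edges.\<close>

lemma central_trivial:
  assumes y: "y \<in> G" "y p = p" "y q = q" and pq: "adj X p q"
    and cp: "\<And>g. g \<in> G \<Longrightarrow> g p = p \<Longrightarrow> comm y g" and cq: "\<And>g. g \<in> G \<Longrightarrow> g q = q \<Longrightarrow> comm y g"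
  shows "y = id"
proof (rule G_eqI[OF y(1) G_id])
  let ?C = "\<lambda>p. y p = p \<and> (\<forall>g\<in>G. g p = p \<longrightarrow> comm y g)"
  let ?P = "\<lambda>q. ?C q \<and> (\<exists>p. adj X p q \<and> ?C p)"
  fix w assume w: "w \<in> verts X"
  have "?P w"
  proof (rule connected_induct[OF adjD(2)[OF pq] w])
    show "?P q" using assms by blast
    fix u w assume "?P u" and uw: "adj X u w"
    then obtain p where u: "?C u" and p: "adj X p u" "?C p" by blast
    obtain g where g: "g \<in> G" "g u = u" "g p = w" using arc_map[OF adjD(4)[OF p(1)] uw] by auto
    have yg: "comm y g" using u g by blast
    then have "y w = w" using g p by (metis comp_apply)
    moreover have "comm y h" if h: "h \<in> G" "h w = w" for h
    proof -
      have "comm y (inv g \<circ> (h \<circ> g))"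
        using p(2) g h by (metis G_comp G_inv comp_apply inv_G(1))
      then have "comm y (g \<circ> (inv g \<circ> (h \<circ> g)))" using yg comm_comp by blast
      then have 1: "comm y (h \<circ> g)" using g by (simp add: fun_eq_iff)
      show ?thesis
      proof
        fix z
        obtain z' where z: "z = g z'" using g by (metis inv_G(2))
        show "(y \<circ> h) z = (h \<circ> y) z"
          using 1 yg unfolding z by (metis comp_apply)
      qed
    qed
    ultimately show "?P w" using u uw by blast
  qed
  then show "y w = id w" by simp
qed

lemma comm_x_near:
  assumes "\<And>m. m < l \<Longrightarrow> comm (x 0) (x (int m))" "\<bar>i - j\<bar> < int l"
  shows "comm (x i) (x j)"
proof (cases "i \<le> j")
  case True
  then show ?thesis using assms(1)[of "nat (j - i)"] comm_x_shift[of i j] assms(2) by auto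
next
  case False
  then show ?thesis using assms(1)[of "nat (i - j)"] comm_x_shift[of j i] assms(2) by auto
qed

text \<open>Otherwise the indices \<open>1 - int s\<close> and 1 both lie at distance less than
  \<open>l\<close> from \<open>2 - int l\<close>. Then \<open>x (2 - int l)\<close> commutes with
  all generators of the stabilizers of the adjacent vertices \<open>v 0\<close> and
  \<open>v 1\<close> and fixes both, against \<open>central_trivial\<close>.\<close>

lemma commuting_bound:
  assumes c: "\<And>m. m < l \<Longrightarrow> comm (x 0) (x (int m))" and l: "l \<le> s"
  shows "2 * l \<le> s + 1"
proof (rule ccontr)
  assume n: "\<not> 2 * l \<le> s + 1"
  then have l2: "2 \<le> l" using s_ge_2 by simp
  let ?y = "x (2 - int l)"
  have st: "comm ?y g" if "g \<in> G" "g (v i) = v i" "i = 0 \<or> i = 1" for g i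
  proof (rule stabilizer_generated[where P = "comm ?y", OF _ _ _ that(1,2)])
    fix k assume "i - int s < k" "k \<le> i"
    then show "comm ?y (x k)" using that(3) n l by (intro comm_x_near[OF c]) auto
  qed (use comm_id comm_comp in auto)
  have "?y = id"
    by (rule central_trivial[of ?y "v 0" "v 1"])
      (use st[of _ 0] st[of _ 1] x_fix[of "2 - int l"] v_adj[of 0] l2 l in auto)
  then show False using x_neq_id by blast
qed

definition \<kappa> :: nat where "\<kappa> = (LEAST m. \<not> comm (x 0) (x (int m)))"

text \<open>With \<open>l = s\<close>, \<open>commuting_bound\<close> would force
  \<open>s \<le> 1\<close>; so the \<open>LEAST\<close> is attained, and below \<open>s\<close>.
  With \<open>l = \<kappa>\<close> it gives the sharper inequality.\<close>

lemma kappa: "\<not> comm (x i) (x (i + int \<kappa>))" "\<bar>i - j\<bar> < int \<kappa> \<Longrightarrow> comm (x i) (x j)"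
  and kappa_bounds: "1 \<le> \<kappa>" "2 * \<kappa> \<le> s + 1" "\<kappa> < s"
proof -
  have "\<exists>m<s. \<not> comm (x 0) (x (int m))" using commuting_bound[of s] s_ge_2 by auto
  then have 1: "\<not> comm (x 0) (x (int \<kappa>))" and ls: "\<kappa> < s"
    unfolding \<kappa>_def by (metis (mono_tags, lifting) LeastI, metis (mono_tags, lifting) Least_le le_less_trans)
  have 2: "comm (x 0) (x (int m))" if "m < \<kappa>" for m using not_less_Least that unfolding \<kappa>_def by blast
  show "\<not> comm (x i) (x (i + int \<kappa>))" using 1 comm_x_shift[of i "i + int \<kappa>"] by simp
  show "comm (x i) (x j)" if "\<bar>i - j\<bar> < int \<kappa>" using comm_x_near[OF 2 that] .
  show "\<kappa> < s" by (rule ls)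
  show "2 * \<kappa> \<le> s + 1" using commuting_bound[of \<kappa>] 2 ls by auto
  show "1 \<le> \<kappa>" using 1 by (cases \<kappa>) auto
qed

text \<open>Both involutions fix \<open>v (i + k)\<close>, ..., \<open>v (i + int s - 1)\<close>, at
  least two vertices since \<open>k + 2 \<le> int s\<close>. At either end they share a fixed vertex
  and its inner neighbour, so their commutator fixes one further vertex on each side.\<close>

lemma commutator_S:
  assumes "1 \<le> k" "k + 2 \<le> int s"
  shows "x i \<circ> x (i + k) \<circ> x i \<circ> x (i + k) \<in> S (i + k - 1) (i + int s)"
proof -
  let ?z = "x i \<circ> x (i + k) \<circ> x i \<circ> x (i + k)"
  have "?z \<in> S (i + k) (i + int s - 1)" using assms by (auto simp: S_def x_fix)
  moreover have "?z (v (i + k - 1)) = v (i + k - 1)"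
    using commutator_fixes_neighbour[OF x_G x_G v_adj[of "i + k"] v_adj'(1)[of "i + k"] v_adj'(2)[symmetric], of i "i + k"]
      assms by (simp add: x_fix)
  moreover have "?z (v (i + int s - 1 + 1)) = v (i + int s - 1 + 1)"
    using commutator_fixes_neighbour[OF x_G x_G v_adj'(1)[of "i + int s - 1"] v_adj[of "i + int s - 1"] v_adj'(2), of i "i + k"]
      assms by (simp add: x_fix)
  ultimately show ?thesis using S_extend_left[OF S_extend_right] by force
qed

text \<open>
  The commutator \<open>z\<close> is a product of \<open>x\<^sub>i\<^sub>+\<^sub>m\<close> and later generators. If \<open>m + \<kappa>\<close> were small, then conjugation
  by \<open>x\<^sub>i\<^sub>+\<^sub>m\<^sub>+\<^sub>\<kappa>\<close>, which fails to commute with exactly the first factor of \<open>z\<close>, would on the other hand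
  multiply \<open>x\<^sub>i\<close> by an element \<open>w\<close> commuting with everything in sight and so fix \<open>z\<close>.
\<close>

lemma commutator_extent:
  assumes m: "1 \<le> m" "m < int \<kappa>" and l: "\<kappa> + 2 \<le> s"
    and z: "z = x i \<circ> x (i + int \<kappa>) \<circ> x i \<circ> x (i + int \<kappa>)"
    and zS: "z \<in> S (i + int \<kappa> - 1) (i + m + int s - 1)"
    and zm: "z (v (i + m + int s)) \<noteq> v (i + m + int s)"
  shows "int s - 1 \<le> m + int \<kappa>"
proof (rule ccontr)
  assume n: "\<not> int s - 1 \<le> m + int \<kappa>"
  define j where "j = m + int \<kappa>"
  let ?y = "x (i + j)" and ?r = "x i" and ?l = "x (i + int \<kappa>)"
  have xm: "x (i + m) \<in> S (i + int \<kappa> - 1) (i + m + int s - 1)"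
    by (rule S_mono[OF x_S]) (use m in auto)
  \<comment> \<open>Removing the factor \<open>x (i + m)\<close> leaves a product of generators with
    indices strictly between \<open>i + m\<close> and \<open>i + int \<kappa>\<close>, all at
    distance less than \<open>\<kappa>\<close> from the index of \<open>?y\<close>.\<close>
  have "x (i + m) \<circ> z \<in> S (i + int \<kappa> - 1) (i + m + int s - 1 + 1)"
    by (rule S_swap_right[OF xm zS]) (use m l zm x_moves_right[of "i + m"] in \<open>auto simp: algebra_simps\<close>)
  then have yu: "comm ?y (x (i + m) \<circ> z)"
    by (rule comm_S[rotated 2]) (use m l in \<open>auto simp: j_def intro!: kappa(2)\<close>)
  have nc: "\<not> comm ?y z"
  proof
    assume yz: "comm ?y z"
    have "?y (x (i + m) t) = x (i + m) (?y t)" for t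
    proof -
      have "z \<in> G" using zS S_G by blast
      then obtain t' where t: "t = z t'" by (metis inv_G(2))
      show ?thesis unfolding t using yu yz by (metis comp_apply)
    qed
    then have "comm (x (i + m)) (x (i + m + int \<kappa>))" by (auto simp: fun_eq_iff j_def algebra_simps)
    then show False using kappa(1) by blast
  qed
  let ?w = "?r \<circ> ?y \<circ> ?r \<circ> ?y"
  have wS: "?w \<in> S (i + j - 1) (i + int s)"
    using commutator_S[of j i] m l n by (auto simp: j_def)
  \<comment> \<open>\<open>?w\<close> is a product of generators with indices from
    \<open>i + 1\<close> to \<open>i + j - 1\<close>, each at distance less than
    \<open>\<kappa>\<close> from every such \<open>k\<close>.\<close>
  have cw: "comm (x k) ?w" if "i + m \<le> k" "k \<le> i + int \<kappa>" for k
    by (rule comm_S[OF _ _ wS]) (use m l n that in \<open>auto simp: j_def intro!: kappa(2)\<close>)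
  have wz: "comm ?w z"
    by (rule comm_S[OF _ _ zS]) (use m l cw in auto)
  have yl: "comm ?y ?l" using m by (intro kappa(2)) (auto simp: j_def)
  have lw: "comm ?l ?w" using cw m by auto
  have 1: "?w (?y (?r t)) = ?r (?y t)" for t by simp
  have "?y (z t) = z (?y t)" for t
  proof -
    have e: "?y (?l t) = ?l (?y t)" "?l (?w t) = ?w (?l t)" "?w (z t) = z (?w t)" for t
      using yl lw wz by (metis comp_apply)+
    \<comment> \<open>The calculation yields
      \<open>?w \<circ> ?y \<circ> z = ?w \<circ> z \<circ> ?y\<close>, and then \<open>?w\<close>
      is cancelled.\<close>
    have "?w (?y (z t)) = ?r (?y (?l (?r (?l t))))" by (simp add: z)
    also have "\<dots> = ?r (?l (?y (?r (?l t))))" by (simp only: e(1))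
    also have "\<dots> = ?r (?l (?r (?w (?y (?l t)))))" by simp
    also have "\<dots> = ?r (?l (?r (?l (?w (?y t)))))" by (simp only: e(1,2))
    also have "\<dots> = z (?w (?y t))" by (simp add: z)
    also have "\<dots> = ?w (z (?y t))" by (simp only: e(3))
    finally show ?thesis using S_G[OF wS] by (metis G_eq_iff)
  qed
  then show False using nc by auto
qed

end

text \<open>Reading the line backwards gives a second instance of the whole setting, so a bound for
  the right end of a segment also yields one for its left end.\<close>

lemma (in shunted_group) reversed: "shunted_group X G s (inv a) (\<lambda>i. v (- i))"
proof unfold_locales
  show "inv a (v (- i)) = v (- (i + 1))" for i
  proof -
    have "v (- i) = a (v (- (i + 1)))" by (simp add: a_v)
    then show ?thesis using a_G by (simp only: inv_G(1))
  qed
  show "v (- i) \<noteq> v (- (i + 2))" for i using v_neq[of "- i - 2"] by (simp add: algebra_simps)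
qed (use s_ge_2 trans faithful a_G v_adj'(1) in \<open>auto simp: algebra_simps\<close>)

context shunted_group
begin

interpretation r: shunted_group X G s "inv a" "\<lambda>i. v (- i)"
  by (rule reversed)

lemma rev_S: "r.S i j = S (- j) (- i)"
proof -
  have "(\<forall>k. i \<le> k \<and> k \<le> j \<longrightarrow> g (v (- k)) = v (- k)) \<longleftrightarrow> (\<forall>k. - j \<le> k \<and> k \<le> - i \<longrightarrow> g (v k) = v k)" for g
    by (metis minus_le_iff le_minus_iff minus_minus)
  then show ?thesis by (auto simp: r.S_def S_def)
qed

text \<open>Positions \<open>i\<close> to \<open>i + int s - 1\<close> of the reversed line are
  positions \<open>1 - int s - i\<close> to \<open>- i\<close> of the original one.\<close>

lemma rev_x: "r.x i = x (1 - int s - i)"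
  by (rule S_x) (use r.x_S[of i] r.x_neq_id[of i] in \<open>auto simp: rev_S algebra_simps\<close>)

lemma rev_kappa: "r.\<kappa> = \<kappa>"
proof -
  have "comm (r.x 0) (r.x (int m)) \<longleftrightarrow> comm (x 0) (x (int m))" for m
    using comm_x_shift[of "1 - int s - int m" "1 - int s"] by (auto simp: rev_x)
  then show ?thesis by (simp add: r.\<kappa>_def \<kappa>_def)
qed

section \<open>Consequences of an odd parity for \<open>s\<close>\<close>

lemma x_parity:
  assumes "parity_hom G \<chi>" shows "\<chi> (x i) = \<chi> (x j)"
proof (rule shift_invariant)
  show "\<chi> (x i) = \<chi> (x (i + 1))" for i
    using x_shift[of i] parity_comp[OF assms] a_G by (metis x_G)
qed

text \<open>All \<open>x i\<close> have the same parity and generate the stabilizer of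
  \<open>v 0\<close>; if they were even, all stabilizers would be even.\<close>

lemma x_odd:
  assumes \<chi>: "parity_hom G \<chi>" "\<not> even_stabilizers X G \<chi>"
  shows "\<chi> (x i)"
proof (rule ccontr)
  assume "\<not> \<chi> (x i)"
  then have e: "\<not> \<chi> (x k)" for k using x_parity[OF \<chi>(1)] by metis
  have "even_stabilizers X G \<chi>"
  proof (rule even_stabilizersI[OF \<chi>(1) adjD(1)[OF v_adj[of 0]]])
    fix g assume g: "g \<in> G" "g (v 0) = v 0"
    have "g \<in> G \<and> \<not> \<chi> g"
    proof (rule stabilizer_generated[where P = "\<lambda>g. g \<in> G \<and> \<not> \<chi> g", OF _ _ _ g])
      fix g h assume "g \<in> G \<and> \<not> \<chi> g" "h \<in> G \<and> \<not> \<chi> h"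
      then show "g \<circ> h \<in> G \<and> \<not> \<chi> (g \<circ> h)" by (simp add: G_comp parity_comp[OF \<chi>(1)])
    qed (simp_all add: e parity_id[OF \<chi>(1)])
    then show "\<not> \<chi> g" by blast
  qed
  with \<chi> show False by blast
qed

lemma odd_stabilizer_cases:
  assumes \<chi>: "parity_hom G \<chi>" "\<not> even_stabilizers X G \<chi>"
  shows "s \<in> {2, 3, 5}"
proof (cases "s \<le> 3")
  case True
  then show ?thesis using s_ge_2 by auto
next
  case False
  then have l: "\<kappa> + 2 \<le> s" using kappa_bounds by auto
  let ?l = "int \<kappa>"
  define z where "z = x 0 \<circ> x ?l \<circ> x 0 \<circ> x ?l"
  have zS: "z \<in> S (?l - 1) (int s)" using commutator_S[of ?l 0] l kappa_bounds by (simp add: z_def)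
  have zid: "z \<noteq> id"
  proof
    assume "z = id"
    then have "x 0 (x ?l (x 0 (x ?l t))) = t" for t unfolding z_def by (metis comp_apply id_apply)
    then have "x 0 (x ?l t) = x ?l (x 0 t)" for t by (metis x_x)
    then show False using kappa(1)[of 0] by auto
  qed
  have "\<exists>m. z (v (int s + int m + 1)) \<noteq> v (int s + int m + 1)"
  proof (rule ccontr)
    assume *: "\<not> ?thesis"
    have "z (v k) = v k" if "?l - 1 \<le> k" for k
      using * S_fix[OF zS that] by (cases "k \<le> int s") (auto dest: spec[of _ "nat (k - int s - 1)"])
    then have "z \<in> S (?l - 1) (?l - 1 + int s)" using S_G[OF zS] by (auto simp: S_def)
    then show False using S_trivial zid by blast
  qed
  then obtain \<mu>' where mu': "z (v (int s + int \<mu>' + 1)) \<noteq> v (int s + int \<mu>' + 1)"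
    "\<And>m. m < \<mu>' \<Longrightarrow> z (v (int s + int m + 1)) = v (int s + int m + 1)"
    using exists_least_iff[of "\<lambda>m. z (v (int s + int m + 1)) \<noteq> v (int s + int m + 1)"] by metis
  have "\<exists>m. z (v (?l - 2 - int m)) \<noteq> v (?l - 2 - int m)"
  proof (rule ccontr)
    assume *: "\<not> ?thesis"
    have "z (v k) = v k" if "k \<le> int s" for k
      using * S_fix[OF zS _ that] by (cases "?l - 1 \<le> k") (auto dest: spec[of _ "nat (?l - 2 - k)"])
    then have "z \<in> S 0 (0 + int s)" using S_G[OF zS] by (auto simp: S_def)
    then show False using S_trivial zid by blast
  qed
  then obtain \<nu>' where nu': "z (v (?l - 2 - int \<nu>')) \<noteq> v (?l - 2 - int \<nu>')"
    "\<And>m. m < \<nu>' \<Longrightarrow> z (v (?l - 2 - int m)) = v (?l - 2 - int m)"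
    using exists_least_iff[of "\<lambda>m. z (v (?l - 2 - int m)) \<noteq> v (?l - 2 - int m)"] by metis
  \<comment> \<open>The maximal segment around the known one that \<open>z\<close> fixes runs from
    position \<open>\<nu>\<close> to \<open>\<mu> + int s - 1\<close>. If
    \<open>\<mu> = \<nu>\<close> it has exactly \<open>s\<close> vertices, like that of
    \<open>x \<mu>\<close>.\<close>
  define \<mu> where "\<mu> = int \<mu>' + 1"
  define \<nu> where "\<nu> = ?l - 1 - int \<nu>'"
  have zfix: "z (v k) = v k" if "\<nu> \<le> k" "k \<le> \<mu> + int s - 1" for k
  proof -
    consider "k < ?l - 1" | "?l - 1 \<le> k" "k \<le> int s" | "int s < k" by linarith
    then show ?thesis
    proof cases
      case 1 then show ?thesis using nu'(2)[of "nat (?l - 2 - k)"] that by (simp add: \<nu>_def)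
    next
      case 2 then show ?thesis using S_fix[OF zS] by blast
    next
      case 3 then show ?thesis using mu'(2)[of "nat (k - int s - 1)"] that by (simp add: \<mu>_def)
    qed
  qed
  have zmn: "z \<in> S \<nu> (\<mu> + int s - 1)" using zfix S_G[OF zS] by (auto simp: S_def)
  have mn: "\<mu> \<le> \<nu>"
  proof (rule ccontr)
    assume "\<not> \<mu> \<le> \<nu>"
    then have "\<nu> + int s \<le> \<mu> + int s - 1" by simp
    then show False using S_trivial[OF zmn] zid by blast
  qed
  have b: "1 \<le> \<mu>" "\<nu> \<le> ?l - 1" by (auto simp: \<mu>_def \<nu>_def)
  have "int s - 1 \<le> \<mu> + ?l"
  proof (rule commutator_extent[of \<mu> z 0])
    show "z \<in> S (0 + ?l - 1) (0 + \<mu> + int s - 1)" by (rule S_mono[OF zmn]) (use b in auto)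
    show "z (v (0 + \<mu> + int s)) \<noteq> v (0 + \<mu> + int s)" using mu'(1) by (simp add: \<mu>_def algebra_simps)
  qed (use b mn l in \<open>auto simp: z_def\<close>)
  \<comment> \<open>The same estimate on the reversed line controls the left end, where the inverse
    of \<open>z\<close> is the corresponding commutator.\<close>
  moreover have "int s - 1 \<le> (?l - \<nu>) + int r.\<kappa>"
  proof (rule r.commutator_extent[of "?l - \<nu>" "inv z" "1 - int s - ?l"])
    have iz: "inv z = x ?l \<circ> x 0 \<circ> x ?l \<circ> x 0"
      by (rule inv_unique_comp) (auto simp: z_def fun_eq_iff)
    then show "inv z = r.x (1 - int s - ?l) \<circ> r.x (1 - int s - ?l + int r.\<kappa>) \<circ>
        r.x (1 - int s - ?l) \<circ> r.x (1 - int s - ?l + int r.\<kappa>)"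
      by (simp add: rev_x rev_kappa)
    have zi: "inv z (v k) = v k \<longleftrightarrow> z (v k) = v k" for k using S_G[OF zS] by (metis inv_G)
    show "inv z \<in> r.S (1 - int s - ?l + int r.\<kappa> - 1) (1 - int s - ?l + (?l - \<nu>) + int s - 1)"
      using S_G[OF zS] zfix b by (auto simp: rev_S rev_kappa S_def zi)
    show "inv z (v (- (1 - int s - ?l + (?l - \<nu>) + int s))) \<noteq> v (- (1 - int s - ?l + (?l - \<nu>) + int s))"
      unfolding zi using nu'(1) by (simp add: \<nu>_def algebra_simps)
  qed (use b mn l in \<open>auto simp: rev_kappa\<close>)
  moreover have "\<mu> \<noteq> \<nu>"
  proof
    assume "\<mu> = \<nu>"
    then have "z = x \<mu>" using S_x[of z \<mu>] zmn zid by simp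
    then have "\<chi> z" using x_odd[OF \<chi>] by simp
    moreover have "\<not> \<chi> z"
      unfolding z_def by (simp add: G_comp parity_comp[OF \<chi>(1)] x_odd[OF \<chi>])
    ultimately show False by blast
  qed
  ultimately have "2 * (int s - 1) < 3 * ?l" using mn by (simp add: rev_kappa)
  moreover have "2 * ?l \<le> int s + 1" using kappa_bounds(2) by linarith
  \<comment> \<open>The two inequalities give \<open>4 * (int s - 1) < 3 * (int s + 1)\<close>, that
    is \<open>s < 7\<close>; for \<open>s = 4\<close> and \<open>s = 6\<close> no integer
    \<open>\<kappa>\<close> satisfies both.\<close>
  ultimately have "s = 5" using False by presburger
  then show ?thesis by simp
qed

end

context cubic_arc_group
begin

text \<open>A nontrivial element fixing \<open>y\<close> moves every neighbour of \<open>y\<close>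
  and hence permutes them in a 3-cycle. Its cube is then trivial, so its parity is zero.\<close>

lemma faithful_1_even_stabilizers:
  assumes f: "walk_faithful G X 1" and \<chi>: "parity_hom G \<chi>"
  shows "even_stabilizers X G \<chi>"
  unfolding even_stabilizers_def
proof (intro ballI impI)
  fix y g assume y: "y \<in> verts X" and g: "g \<in> G" "g y = y"
  have fix1: "h = id" if "h \<in> G" "h y = y" "adj X y u" "h u = u" for h u
  proof -
    have "walk X 1 (\<lambda>i. if i = 0 then y else u)" using that by (simp add: walk_def)
    then show ?thesis using f that unfolding walk_faithful_def
      by (elim allE[of _ "\<lambda>i. if i = 0 then y else u"] allE[of _ h]) auto
  qed
  show "\<not> \<chi> g"
  proof (cases "g = id")
    case True
    then show ?thesis using parity_id[OF \<chi>] by simp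
  next
    case False
    obtain u where u: "adj X y u" using ex_neighbour[OF y] by blast
    have 1: "adj X y (g u)" "adj X y (g (g u))" "adj X y (g (g (g u)))"
      using u g by (metis G_adj)+
    have 2: "g w \<noteq> w" if "adj X y w" for w using fix1[OF g that] False by blast
    have 3: "g (g u) \<noteq> u"
    proof
      assume *: "g (g u) = u"
      obtain t where t: "adj X y t" "t \<noteq> u" "t \<noteq> g u" "\<And>w. adj X y w \<Longrightarrow> w = u \<or> w = g u \<or> w = t"
        using third_neighbour[OF u 1(1)] 2[OF u] by metis
      have "adj X y (g t)" using t g by (metis G_adj)
      then show False using t(4)[of "g t"] 2[OF t(1)] t * g by (metis G_eq_iff)
    qed
    obtain t where t: "\<And>w. adj X y w \<Longrightarrow> w = u \<or> w = g u \<or> w = t"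
      using third_neighbour[OF u 1(1)] 2[OF u] by metis
    have "g (g (g u)) = u" using t[of "g (g (g u))"] t[of "g (g u)"] 1 2 3 g by (metis G_eq_iff)
    then have "g \<circ> (g \<circ> g) = id" using fix1[of "g \<circ> (g \<circ> g)" u] g u by (simp add: G_comp)
    moreover have "\<chi> (g \<circ> (g \<circ> g)) = \<chi> g" using parity_comp[OF \<chi>] g by (simp add: G_comp)
    ultimately show ?thesis using parity_id[OF \<chi>] by simp
  qed
qed

lemma odd_stabilizers_shunt:
  assumes "walk_transitive G X s" "walk_faithful G X s" "1 \<le> s"
    and "parity_hom G \<chi>" "\<not> even_stabilizers X G \<chi>"
  obtains a v where "shunted_group X G s a v"
proof -
  have "s \<noteq> 1" using faithful_1_even_stabilizers assms by blast
  obtain a v where "a \<in> G" "\<And>i::int. a (v i) = v (i + 1)" "\<And>i. adj X (v i) (v (i + 1))"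
    "\<And>i. v i \<noteq> v (i + 2)" by (rule ex_shunt) auto
  then have "shunted_group X G s a v"
    using assms \<open>s \<noteq> 1\<close> by unfold_locales auto
  then show ?thesis by (rule that)
qed

lemma odd_stabilizers_regularity:
  assumes "walk_transitive G X s" "walk_faithful G X s" "1 \<le> s"
    and "parity_hom G \<chi>" "\<not> even_stabilizers X G \<chi>"
  shows "s \<in> {2, 3, 5}"
  using odd_stabilizers_shunt[OF assms] shunted_group.odd_stabilizer_cases assms(4,5) by metis

text \<open>Both parities are true on every \<open>x i\<close>, so their sum is false there, which
  \<open>x_odd\<close> forbids for an odd parity.\<close>

lemma odd_stabilizers_agree:
  assumes \<chi>: "parity_hom G \<chi>" "\<not> even_stabilizers X G \<chi>"
    and \<psi>: "parity_hom G \<psi>" "\<not> even_stabilizers X G \<psi>"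
  shows "even_stabilizers X G (\<lambda>g. \<chi> g \<noteq> \<psi> g)"
proof (rule ccontr)
  assume n: "\<not> even_stabilizers X G (\<lambda>g. \<chi> g \<noteq> \<psi> g)"
  obtain s where s: "s \<ge> 1" "walk_transitive G X s" "walk_faithful G X s" by (rule ex_walk_regular)
  obtain a v where "shunted_group X G s a v" using odd_stabilizers_shunt[OF s(2,3,1) \<chi>] by metis
  then interpret shunted_group X G s a v .
  show False using x_odd[OF \<chi>] x_odd[OF \<psi>] x_odd[OF parity_add[OF \<chi>(1) \<psi>(1)] n] by blast
qed

end

section \<open>Parities and complements along a 2-cover\<close>

locale lifted_two_cover = cubic_arc_group X G for X :: "'v graph" and G +
  fixes Y :: "'v graph" and p :: "'v \<Rightarrow> 'v"
  assumes Y_simple: "simple_graph Y" and Y_conn: "connected_graph Y"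
    and cover: "two_cover p Y X" and lft: "lifts p Y G"
begin

abbreviation G' :: "('v \<Rightarrow> 'v) set" where "G' \<equiv> lifted_group p Y G"

section \<open>Lifting elements and walks\<close>

lemma Y_adjD: "adj Y x y \<Longrightarrow> x \<in> verts Y" "adj Y x y \<Longrightarrow> y \<in> verts Y" "adj Y x y \<Longrightarrow> adj Y y x"
  using Y_simple unfolding simple_graph_def by auto

lemma p_cov: "covering_projection p Y X"
  using cover by (simp add: two_cover_def regular_covering_def)

lemma p_adj: "adj Y u v \<Longrightarrow> adj X (p u) (p v)"
  using p_cov by (auto simp: covering_projection_def)

lemma p_verts: "y \<in> verts Y \<Longrightarrow> p y \<in> verts X"
  using p_cov by (auto simp: covering_projection_def)

lemma p_surj: assumes "x \<in> verts X" obtains y where "y \<in> verts Y" "p y = x"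
proof -
  have "x \<in> p ` verts Y" using p_cov assms by (simp add: covering_projection_def)
  then show ?thesis using that by blast
qed

lemma p_nbhd: "y \<in> verts Y \<Longrightarrow> bij_betw p (nbhd Y y) (nbhd X (p y))"
  using p_cov by (auto simp: covering_projection_def)

lemma p_nbhd_inj: "adj Y y u \<Longrightarrow> adj Y y w \<Longrightarrow> p u = p w \<Longrightarrow> u = w"
  using p_nbhd[of y] Y_adjD by (auto simp: bij_betw_def inj_on_def nbhd_def)

lemma fibre: "y \<in> verts Y \<Longrightarrow> y' \<in> verts Y \<Longrightarrow> p y = p y' \<Longrightarrow> \<exists>!c. c \<in> CT p Y \<and> c y = y'"
  using cover by (simp add: two_cover_def regular_covering_def)

lemma CT_lift: "c \<in> CT p Y \<longleftrightarrow> is_lift p Y id c"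
  by (auto simp: CT_def is_lift_def)

lemma CT_fix: "c \<in> CT p Y \<Longrightarrow> y \<in> verts Y \<Longrightarrow> c y = y \<Longrightarrow> c = id"
proof -
  assume *: "c \<in> CT p Y" "y \<in> verts Y" "c y = y"
  have "id \<in> CT p Y" by (simp add: CT_def aut_id)
  then show ?thesis using fibre[OF *(2,2)] * by (metis id_apply)
qed

lemma lift_verts: "is_lift p Y g g' \<Longrightarrow> y \<in> verts Y \<Longrightarrow> g' y \<in> verts Y"
  using aut_verts[OF _ Y_simple] by (auto simp: is_lift_def)

lemma lift_comp: "is_lift p Y g g' \<Longrightarrow> is_lift p Y h h' \<Longrightarrow> is_lift p Y (g \<circ> h) (g' \<circ> h')"
  using aut_comp[OF _ _ Y_simple] aut_verts[OF _ Y_simple] by (auto simp: is_lift_def)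

lemma lift_inv:
  assumes "g \<in> G" "is_lift p Y g g'" shows "is_lift p Y (inv g) (inv g')"
proof -
  have a: "g' \<in> aut Y" using assms by (simp add: is_lift_def)
  have b: "g' (inv g' y) = y" for y using aut_bij[OF a Y_simple] by (simp add: bij_is_surj surj_f_inv_f)
  have ai: "inv g' \<in> aut Y" using aut_inv[OF a Y_simple] .
  have "p (inv g' y) = inv g (p y)" if "y \<in> verts Y" for y
  proof -
    have "inv g' y \<in> verts Y" using aut_verts[OF ai Y_simple] that by simp
    then have "p y = g (p (inv g' y))" using assms(2) b by (auto simp: is_lift_def)
    then show ?thesis using assms(1) by simp
  qed
  then show ?thesis using ai by (simp add: is_lift_def)
qed

lemma G'_iff: "g' \<in> G' \<longleftrightarrow> (\<exists>g\<in>G. is_lift p Y g g')"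
  by (auto simp: lifted_group_def)

lemma CT_sub: "c \<in> CT p Y \<Longrightarrow> c \<in> G'"
  using CT_lift G'_iff by blast

text \<open>An arbitrary lift is corrected by a covering transformation, as these act transitively
  on the fibre over \<open>g (p y)\<close>.\<close>

lemma lift_at:
  assumes "g \<in> G" "y \<in> verts Y" "y' \<in> verts Y" "p y' = g (p y)"
  obtains g' where "is_lift p Y g g'" "g' \<in> G'" "g' y = y'"
proof -
  obtain h where h: "is_lift p Y g h" using lft assms by (auto simp: lifts_def)
  have "p (h y) = p y'" using h assms by (auto simp: is_lift_def)
  then obtain c where c: "c \<in> CT p Y" "c (h y) = y'"
    using fibre[OF lift_verts[OF h assms(2)] assms(3)] by auto
  have "is_lift p Y g (c \<circ> h)" using lift_comp[OF _ h, of id c] c CT_lift by simp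
  then show ?thesis using that[of "c \<circ> h"] c G'_iff assms by auto
qed

lemma G'_sub: "aut_subgroup G' Y"
  unfolding aut_subgroup_def
proof (intro conjI ballI)
  show "G' \<subseteq> aut Y" by (auto simp: lifted_group_def is_lift_def)
  show "id \<in> G'" using CT_sub by (simp add: CT_def aut_id)
  show "h \<circ> g \<in> G'" if "g \<in> G'" "h \<in> G'" for g h
    using that lift_comp unfolding G'_iff by blast
  fix g' assume "g' \<in> G'"
  then obtain g where g: "g \<in> G" "is_lift p Y g g'" unfolding G'_iff by blast
  have "inv g' \<in> G'" using lift_inv[OF g] g G'_iff by blast
  moreover have "inv g' \<circ> g' = id"
    using g aut_bij[OF _ Y_simple, of g'] by (simp add: is_lift_def bij_is_inj)
  ultimately show "\<exists>h\<in>G'. h \<circ> g' = id" by blast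
qed

lemma walk_proj: "walk Y m f \<Longrightarrow> walk X m (p \<circ> f)"
  unfolding walk_def
proof (intro conjI allI impI; elim conjE)
  fix i assume *: "\<forall>i<m. adj Y (f i) (f (Suc i))" "\<forall>i. Suc i < m \<longrightarrow> f i \<noteq> f (Suc (Suc i))" "Suc i < m"
  then have "adj Y (f (Suc i)) (f i)" "adj Y (f (Suc i)) (f (Suc (Suc i)))" using Y_adjD(3) by auto
  then show "(p \<circ> f) i \<noteq> (p \<circ> f) (Suc (Suc i))" using p_nbhd_inj * by auto
qed (auto intro: p_adj)

text \<open>An element matching the projected walks is lifted so that the starting vertices match;
  local injectivity of \<open>p\<close> forces the remaining vertices to follow.\<close>

lemma walk_transitive_lift:
  assumes tr: "walk_transitive G X m" and m: "1 \<le> m" shows "walk_transitive G' Y m"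
  unfolding walk_transitive_def
proof (intro allI impI)
  fix f f' assume f: "walk Y m f" and f': "walk Y m f'"
  obtain g where g0: "g \<in> G" "\<forall>i\<le>m. g ((p \<circ> f) i) = (p \<circ> f') i"
    using tr walk_proj[OF f] walk_proj[OF f'] unfolding walk_transitive_def by blast
  then have g: "g \<in> G" "\<And>i. i \<le> m \<Longrightarrow> g (p (f i)) = p (f' i)" by auto
  have v: "f 0 \<in> verts Y" "f' 0 \<in> verts Y" using f f' m Y_adjD by (auto simp: walk_def)
  obtain g' where g': "is_lift p Y g g'" "g' \<in> G'" "g' (f 0) = f' 0"
    using lift_at[OF g(1) v] g(2)[of 0] by auto
  have "g' (f i) = f' i" if "i \<le> m" for i
    using that
  proof (induction i)
    case (Suc i)
    have a: "adj Y (f i) (f (Suc i))" "adj Y (f' i) (f' (Suc i))" using f f' Suc by (auto simp: walk_def)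
    have "adj Y (f' i) (g' (f (Suc i)))"
      using Suc a(1) g'(1) aut_adj[OF _ Y_simple, of g' "f i" "f (Suc i)"] by (auto simp: is_lift_def)
    moreover have "p (g' (f (Suc i))) = p (f' (Suc i))"
      using g'(1) g(2)[of "Suc i"] Suc.prems Y_adjD(2)[OF a(1)] by (simp add: is_lift_def)
    ultimately show ?case using p_nbhd_inj a(2) by blast
  qed (use g' in simp)
  then show "\<exists>g\<in>G'. \<forall>i\<le>m. g (f i) = f' i" using g' by blast
qed

text \<open>The element below fixes the projected walk and is therefore \<open>id\<close>; a
  covering transformation with a fixed vertex is trivial.\<close>

lemma walk_faithful_lift:
  assumes fa: "walk_faithful G X m" and m: "1 \<le> m" shows "walk_faithful G' Y m"
  unfolding walk_faithful_def
proof (intro allI impI)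
  fix f g' assume f: "walk Y m f" and g': "g' \<in> G'" "\<forall>i\<le>m. g' (f i) = f i"
  then obtain g where g: "g \<in> G" "is_lift p Y g g'" unfolding G'_iff by blast
  have v: "f i \<in> verts Y" if "i \<le> m" for i
    using f that m Y_adjD unfolding walk_def by (metis One_nat_def Suc_le_eq le_neq_implies_less lessI less_Suc_eq_0_disj not0_implies_Suc zero_less_Suc)
  have "g ((p \<circ> f) i) = (p \<circ> f) i" if "i \<le> m" for i
    using g(2) g'(2) that v[OF that] by (simp add: is_lift_def) metis
  then have "g = id" using fa walk_proj[OF f] g(1) unfolding walk_faithful_def by blast
  then show "g' = id" using g(2) CT_lift CT_fix[of g' "f 0"] v[of 0] g'(2) by auto
qed

sublocale up: cubic_arc_group Y G'
proof
  show "simple_graph Y" "connected_graph Y" by (rule Y_simple, rule Y_conn)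
  show "cubic Y" unfolding cubic_def
    using p_nbhd bij_betw_same_card nbhd_card p_verts by metis
  show "aut_subgroup G' Y" by (rule G'_sub)
  show "arc_transitive G' Y" unfolding arc_transitive_def
  proof (intro allI impI)
    fix u v u' v' assume *: "adj Y u v" "adj Y u' v'"
    have "walk Y 1 (\<lambda>i. if i = 0 then u else v)" "walk Y 1 (\<lambda>i. if i = 0 then u' else v')"
      using * by (auto simp: walk_def)
    then obtain g where "g \<in> G'" "\<forall>i\<le>1. g (if i = (0::nat) then u else v) = (if i = 0 then u' else v')"
      using walk_transitive_lift[OF walk_transitive_1] unfolding walk_transitive_def by blast
    then show "\<exists>g\<in>G'. g u = u' \<and> g v = v'" by (metis le_refl zero_le zero_neq_one)
  qed
qed

section \<open>The projection of the lifted group and its kernel of order two\<close>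

definition \<pi> :: "('v \<Rightarrow> 'v) \<Rightarrow> 'v \<Rightarrow> 'v" where
  "\<pi> g' = (THE g. g \<in> G \<and> is_lift p Y g g')"

lemma pi_eq: assumes "g \<in> G" "is_lift p Y g g'" shows "\<pi> g' = g"
  unfolding \<pi>_def
proof (rule the_equality)
  fix h assume h: "h \<in> G \<and> is_lift p Y h g'"
  show "h = g"
  proof (rule G_eqI)
    fix x assume "x \<in> verts X"
    then obtain y where y: "y \<in> verts Y" "p y = x" by (rule p_surj)
    then show "h x = g x" using h assms unfolding is_lift_def by metis
  qed (use h assms in auto)
qed (use assms in auto)

lemma pi: assumes "g' \<in> G'" shows pi_G: "\<pi> g' \<in> G" and pi_lift: "is_lift p Y (\<pi> g') g'"
  using assms pi_eq unfolding G'_iff by auto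

lemma pi_p: "g' \<in> G' \<Longrightarrow> y \<in> verts Y \<Longrightarrow> p (g' y) = \<pi> g' (p y)"
  using pi_lift by (simp add: is_lift_def)

lemma pi_comp: "g' \<in> G' \<Longrightarrow> h' \<in> G' \<Longrightarrow> \<pi> (g' \<circ> h') = \<pi> g' \<circ> \<pi> h'"
  using pi_eq[OF G_comp lift_comp] pi by simp

lemma pi_surj:
  assumes "g \<in> G" "y \<in> verts Y" "g (p y) = p y"
  obtains g' where "g' \<in> G'" "\<pi> g' = g" "g' y = y"
  using lift_at[OF assms(1,2,2)] assms pi_eq by metis

lemma pi_surj': assumes "g \<in> G" obtains g' where "g' \<in> G'" "\<pi> g' = g"
  using assms lft pi_eq G'_iff unfolding lifts_def by metis

definition \<tau> :: "'v \<Rightarrow> 'v" where "\<tau> = (SOME c. c \<in> CT p Y \<and> c \<noteq> id)"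

lemma CT_eq: "CT p Y = {id, \<tau>}" and tau_neq: "\<tau> \<noteq> id"
proof -
  have c: "card (CT p Y) = 2" using cover by (simp add: two_cover_def)
  have i: "id \<in> CT p Y" by (simp add: CT_def aut_id)
  have "\<exists>c. c \<in> CT p Y \<and> c \<noteq> id"
  proof (rule ccontr)
    assume "\<not> ?thesis"
    then have "CT p Y = {id}" using i by auto
    then show False using c by simp
  qed
  then have t: "\<tau> \<in> CT p Y \<and> \<tau> \<noteq> id" unfolding \<tau>_def by (rule someI_ex)
  then show "\<tau> \<noteq> id" by blast
  have "{id, \<tau>} = CT p Y"
    by (rule card_subset_eq) (use c t i card.infinite in \<open>auto intro: ccontr\<close>)
  then show "CT p Y = {id, \<tau>}" by simp
qed

lemma tau_G: "\<tau> \<in> G'"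
  using CT_eq CT_sub by blast

lemma pi_id_iff: "g' \<in> G' \<Longrightarrow> \<pi> g' = id \<longleftrightarrow> g' = id \<or> g' = \<tau>"
  using CT_eq CT_lift pi_lift pi_eq[OF G_id] by (metis empty_iff insert_iff)

lemma pi_tau: "\<pi> \<tau> = id"
  using pi_id_iff tau_G by blast

lemma pi_ident: "\<pi> id = id"
  using pi_id_iff up.G_id by blast

lemma tau_tau: "\<tau> \<circ> \<tau> = id"
proof -
  have "\<pi> (\<tau> \<circ> \<tau>) = id" using pi_comp pi_tau tau_G by simp
  then have "\<tau> \<circ> \<tau> = id \<or> \<tau> \<circ> \<tau> = \<tau>" using pi_id_iff tau_G by blast
  then show ?thesis using up.G_eq_iff[OF tau_G] tau_neq by (metis comp_apply ext id_apply)
qed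

text \<open>The kernel of \<open>\<pi>\<close> is a normal subgroup of order two, so conjugation
  cannot move its nontrivial element.\<close>

lemma tau_central: assumes "g \<in> G'" shows "g \<circ> \<tau> = \<tau> \<circ> g"
proof -
  have i: "inv g \<in> G'" using assms by blast
  have pg: "\<pi> g \<circ> \<pi> (inv g) = id"
    using pi_comp[OF assms i] pi_ident up.comp_inv[OF assms] by simp
  have "\<pi> (g \<circ> \<tau> \<circ> inv g) = id"
    using assms i tau_G by (simp add: pi_comp up.G_comp pi_tau pg)
  then consider "g \<circ> \<tau> \<circ> inv g = id" | "g \<circ> \<tau> \<circ> inv g = \<tau>"
    using pi_id_iff assms i tau_G by blast
  then show ?thesis
  proof cases
    case 1
    then have "g (\<tau> y) = g y" for y using up.inv_G(1)[OF assms] by (metis comp_apply id_apply)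
    then show ?thesis using tau_neq up.G_eq_iff[OF assms] by (metis eq_id_iff)
  next
    case 2
    then show ?thesis using up.inv_G(1)[OF assms] by (metis comp_apply ext)
  qed
qed

section \<open>Pullback and descent of parities\<close>

lemma parity_pullback: "parity_hom G \<chi> \<Longrightarrow> parity_hom G' (\<chi> \<circ> \<pi>)"
  by (simp add: parity_hom_def pi_comp pi_G)

lemma parity_pullback_tau: "parity_hom G \<chi> \<Longrightarrow> \<not> (\<chi> \<circ> \<pi>) \<tau>"
  using parity_id pi_tau by simp

text \<open>\<open>\<pi>\<close> maps the stabilizer of \<open>y\<close> onto that of
  \<open>p y\<close>, because a lift can be chosen to fix \<open>y\<close>.\<close>

lemma even_pullback:
  assumes "parity_hom G \<chi>"
  shows "even_stabilizers Y G' (\<chi> \<circ> \<pi>) \<longleftrightarrow> even_stabilizers X G \<chi>"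
proof
  assume "even_stabilizers X G \<chi>"
  then show "even_stabilizers Y G' (\<chi> \<circ> \<pi>)"
    unfolding even_stabilizers_def using pi_p pi_G p_verts by (metis comp_apply)
next
  assume *: "even_stabilizers Y G' (\<chi> \<circ> \<pi>)"
  show "even_stabilizers X G \<chi>"
    unfolding even_stabilizers_def
  proof (intro ballI impI)
    fix x g assume x: "x \<in> verts X" "g \<in> G" "g x = x"
    obtain y where y: "y \<in> verts Y" "p y = x" using p_surj x by blast
    obtain g' where "g' \<in> G'" "\<pi> g' = g" "g' y = y" using pi_surj[OF x(2) y(1)] x y by auto
    then show "\<not> \<chi> g" using * y unfolding even_stabilizers_def by auto
  qed
qed

text \<open>Elements with the same image under \<open>\<pi>\<close> differ by \<open>id\<close> or
  \<open>\<tau>\<close>, which both have parity zero, so \<open>\<chi>\<close> is constant on the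
  fibres of \<open>\<pi>\<close>.\<close>

lemma parity_descends:
  assumes \<chi>: "parity_hom G' \<chi>" "\<not> \<chi> \<tau>"
  obtains \<psi> where "parity_hom G \<psi>" "\<And>g'. g' \<in> G' \<Longrightarrow> \<chi> g' = (\<psi> \<circ> \<pi>) g'"
proof -
  define \<psi> where "\<psi> g = (\<exists>g'\<in>G'. \<pi> g' = g \<and> \<chi> g')" for g
  have eq: "\<chi> g = \<chi> h" if "g \<in> G'" "h \<in> G'" "\<pi> g = \<pi> h" for g h
  proof -
    have i: "inv h \<in> G'" using that by blast
    have "\<pi> h \<circ> \<pi> (inv h) = id"
      using pi_comp[OF that(2) i] pi_ident up.comp_inv[OF that(2)] by simp
    then have "\<pi> (g \<circ> inv h) = id" using pi_comp that i by simp
    then have "\<not> \<chi> (g \<circ> inv h)"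
      using pi_id_iff[of "g \<circ> inv h"] that i \<chi>(2) up.parity_id[OF \<chi>(1)] by (metis up.G_comp)
    then show ?thesis using up.parity_comp[OF \<chi>(1) that(1) i] up.parity_inv[OF \<chi>(1) that(2)] by blast
  qed
  have e: "\<chi> g' = (\<psi> \<circ> \<pi>) g'" if "g' \<in> G'" for g'
  proof
    show "\<chi> g' \<Longrightarrow> (\<psi> \<circ> \<pi>) g'" using that by (auto simp: \<psi>_def)
    assume "(\<psi> \<circ> \<pi>) g'"
    then obtain h where "h \<in> G'" "\<pi> h = \<pi> g'" "\<chi> h" by (auto simp: \<psi>_def)
    then show "\<chi> g'" using eq[OF _ that] by simp
  qed
  have "parity_hom G \<psi>" unfolding parity_hom_def
  proof (intro ballI)
    fix g h assume "g \<in> G" "h \<in> G"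
    obtain g' where "g' \<in> G'" "\<pi> g' = g" using pi_surj'[OF \<open>g \<in> G\<close>] by blast
    moreover obtain h' where "h' \<in> G'" "\<pi> h' = h" using pi_surj'[OF \<open>h \<in> G\<close>] by blast
    ultimately show "\<psi> (g \<circ> h) = (\<psi> g \<noteq> \<psi> h)"
      using e[of "g' \<circ> h'"] e[of g'] e[of h'] up.parity_comp[OF \<chi>(1), of g' h'] pi_comp[of g' h'] by auto
  qed
  then show ?thesis using that e by blast
qed

section \<open>Complements as kernels of parities\<close>

lemma complement_parity:
  assumes "is_complement H p Y G"
  shows "parity_hom G' (\<lambda>g. g \<notin> H)" "\<tau> \<notin> H" "H \<subseteq> G'"
proof -
  have H: "aut_subgroup H Y" "H \<subseteq> G'" "H \<inter> {id, \<tau>} = {id}"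
    and cov: "{c \<circ> h | h c. h \<in> H \<and> c \<in> {id, \<tau>}} = G'"
    using assms unfolding is_complement_def CT_eq by auto
  show "H \<subseteq> G'" by fact
  show t: "\<tau> \<notin> H" using H tau_neq by auto
  have Hc: "g \<circ> h \<in> H" if "g \<in> H" "h \<in> H" for g h using that H(1) by (simp add: aut_subgroup_def)
  \<comment> \<open>\<open>G'\<close> is the union of \<open>H\<close> and its coset by
    \<open>\<tau>\<close>. As \<open>\<tau>\<close> is central, these two cosets multiply as in
    Z/2.\<close>
  have out: "\<exists>h\<in>H. g = \<tau> \<circ> h" if "g \<in> G'" "g \<notin> H" for g
  proof -
    have "g \<in> {c \<circ> h | h c. h \<in> H \<and> c \<in> {id, \<tau>}}" using cov that(1) by simp
    then obtain h c where "g = c \<circ> h" "h \<in> H" "c \<in> {id, \<tau>}" by blast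
    then show ?thesis using that(2) by auto
  qed
  have tH: "\<tau> \<circ> h \<notin> H" if h: "h \<in> H" for h
  proof
    assume *: "\<tau> \<circ> h \<in> H"
    obtain h' where h': "h' \<in> H" "h' \<circ> h = id" using H(1) h by (auto simp: aut_subgroup_def)
    have "h' \<circ> (\<tau> \<circ> h) = \<tau>" using tau_central[of h'] h' H(2) by (metis comp_assoc comp_id subsetD)
    then show False using Hc[OF h'(1) *] t by simp
  qed
  show "parity_hom G' (\<lambda>g. g \<notin> H)" unfolding parity_hom_def
  proof (intro ballI)
    fix g h assume g: "g \<in> G'" and h: "h \<in> G'"
    consider "g \<in> H" "h \<in> H" | "g \<in> H" "h \<notin> H" | "g \<notin> H" "h \<in> H" | "g \<notin> H" "h \<notin> H" by blast
    then show "(g \<circ> h \<notin> H) = ((g \<notin> H) \<noteq> (h \<notin> H))"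
    proof cases
      case 2
      then obtain h1 where "h1 \<in> H" "h = \<tau> \<circ> h1" using out h by blast
      then have "g \<circ> h = \<tau> \<circ> (g \<circ> h1)" using tau_central[OF g] by (metis comp_assoc)
      then show ?thesis using tH Hc 2 \<open>h1 \<in> H\<close> by simp
    next
      case 3
      then obtain g1 where "g1 \<in> H" "g = \<tau> \<circ> g1" using out g by blast
      then have "g \<circ> h = \<tau> \<circ> (g1 \<circ> h)" by (simp add: comp_assoc)
      then show ?thesis using tH Hc 3 \<open>g1 \<in> H\<close> by simp
    next
      case 4
      then obtain g1 h1 where *: "g1 \<in> H" "g = \<tau> \<circ> g1" "h1 \<in> H" "h = \<tau> \<circ> h1" using out g h by metis
      have "g \<circ> h = \<tau> \<circ> (g1 \<circ> \<tau>) \<circ> h1" using * by (simp add: comp_assoc)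
      also have "\<dots> = \<tau> \<circ> \<tau> \<circ> (g1 \<circ> h1)" using tau_central[of g1] * H(2) by (simp add: comp_assoc subset_iff)
      also have "\<dots> = g1 \<circ> h1" by (simp add: tau_tau)
      finally show ?thesis using Hc 4 * by simp
    qed (use Hc in simp)
  qed
qed

lemma parity_complement:
  assumes \<chi>: "parity_hom G' \<chi>" "\<chi> \<tau>"
  shows "is_complement {g \<in> G'. \<not> \<chi> g} p Y G"
  unfolding is_complement_def
proof (intro conjI)
  let ?H = "{g \<in> G'. \<not> \<chi> g}"
  show "aut_subgroup ?H Y" unfolding aut_subgroup_def
  proof (intro conjI ballI)
    show "?H \<subseteq> aut Y" using up.G_aut by blast
    show "id \<in> ?H" using up.parity_id[OF \<chi>(1)] by simp
    show "h \<circ> g \<in> ?H" if "g \<in> ?H" "h \<in> ?H" for g h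
      using that up.parity_comp[OF \<chi>(1)] by (simp add: up.G_comp)
    show "\<exists>h\<in>?H. h \<circ> g = id" if "g \<in> ?H" for g
      using that up.parity_inv[OF \<chi>(1)] by (intro bexI[of _ "inv g"]) auto
  qed
  show "?H \<subseteq> G'" by blast
  show "?H \<inter> CT p Y = {id}" unfolding CT_eq using \<chi>(2) up.parity_id[OF \<chi>(1)] by auto
  show "{c \<circ> h |h c. h \<in> ?H \<and> c \<in> CT p Y} = G'"
  proof (intro equalityI subsetI)
    fix g assume g: "g \<in> G'"
    show "g \<in> {c \<circ> h |h c. h \<in> ?H \<and> c \<in> CT p Y}"
    proof (cases "\<chi> g")
      case True
      have "\<tau> \<circ> g \<in> ?H" using g tau_G True \<chi>(2) up.parity_comp[OF \<chi>(1)] by (simp add: up.G_comp)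
      moreover have "g = \<tau> \<circ> (\<tau> \<circ> g)" by (simp add: tau_tau flip: comp_assoc)
      ultimately show ?thesis using CT_eq by blast
    next
      case False
      then have "g \<in> ?H" "g = id \<circ> g" using g by auto
      then show ?thesis using CT_eq by blast
    qed
  qed (use CT_sub in blast)
qed

text \<open>The orbit of a vertex under \<open>H\<close> serves as section. It meets every fibre
  because an element outside \<open>H\<close> is brought into \<open>H\<close> by
  \<open>\<tau>\<close>, which preserves fibres.\<close>

lemma complement_sectional:
  assumes H: "is_complement H p Y G" and ev: "even_stabilizers Y G' (\<lambda>g. g \<notin> H)"
  shows "sectional H p Y X"
proof -
  note P = complement_parity[OF H]
  have sub: "aut_subgroup H Y" using H by (simp add: is_complement_def)
  have Hc: "g \<circ> h \<in> H" if "g \<in> H" "h \<in> H" for g h using that sub by (simp add: aut_subgroup_def)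
  have Hi: "inv h \<in> H" if "h \<in> H" for h using up.parity_inv[OF P(1), of h] that P(3) by blast
  obtain y0 where y0: "y0 \<in> verts Y" by (rule up.ex_vertex)
  let ?S = "(\<lambda>h. h y0) ` H"
  have "is_section p Y X ?S" unfolding is_section_def
  proof (intro conjI ballI)
    show "?S \<subseteq> verts Y" using y0 P(3) by auto
    fix x assume x: "x \<in> verts X"
    obtain y where y: "y \<in> verts Y" "p y = x" using p_surj x by blast
    obtain g where g: "g \<in> G'" "g y0 = y" using up.vertex_map y0 y by blast
    have ex: "\<exists>h\<in>H. p (h y0) = x"
    proof (cases "g \<in> H")
      case False
      then have "\<tau> \<circ> g \<in> H" using up.parity_comp[OF P(1) tau_G g(1)] P(2) by blast
      moreover have "p ((\<tau> \<circ> g) y0) = x" using pi_p[OF tau_G y(1)] pi_tau y g by simp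
      ultimately show ?thesis by blast
    qed (use g y in auto)
    \<comment> \<open>Two different orbit points in one fibre are exchanged by
      \<open>\<tau>\<close>. Then \<open>inv k \<circ> (\<tau> \<circ> h)\<close> fixes
      \<open>y0\<close>, so it lies in \<open>H\<close> by evenness, although its parity is that of
      \<open>\<tau>\<close>.\<close>
    have un: "h y0 = k y0" if hk: "h \<in> H" "k \<in> H" "p (h y0) = p (k y0)" for h k
    proof (rule ccontr)
      assume n: "h y0 \<noteq> k y0"
      have "h y0 \<in> verts Y" "k y0 \<in> verts Y" using that y0 P(3) by auto
      then obtain c where "c \<in> CT p Y" "c (h y0) = k y0" using fibre[of "h y0" "k y0"] hk(3) by auto
      then have "\<tau> (h y0) = k y0" using CT_eq n by auto
      then have "(inv k \<circ> (\<tau> \<circ> h)) y0 = y0" using that(2) P(3) by (metis comp_apply subsetD up.inv_G(1))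
      moreover have k: "inv k \<in> H" using Hi that by blast
      moreover have "inv k \<circ> (\<tau> \<circ> h) \<in> G'" using k that P(3) tau_G by blast
      ultimately have in_H: "inv k \<circ> (\<tau> \<circ> h) \<in> H"
        using ev y0 unfolding even_stabilizers_def by blast
      have G: "inv k \<in> G'" "h \<in> G'" using k hk P(3) by auto
      have "\<tau> \<circ> h \<notin> H" using up.parity_comp[OF P(1) tau_G G(2)] P(2) hk(1) by simp
      then have "inv k \<circ> (\<tau> \<circ> h) \<notin> H"
        using up.parity_comp[OF P(1) G(1) up.G_comp[OF tau_G G(2)]] k by simp
      then show False using in_H by (rule notE)
    qed
    show "\<exists>!y. y \<in> ?S \<and> p y = x"
    proof (rule ex_ex1I)
      show "\<exists>y. y \<in> ?S \<and> p y = x" using ex by blast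
      fix u w assume "u \<in> ?S \<and> p u = x" "w \<in> ?S \<and> p w = x"
      then show "u = w" using un by auto
    qed
  qed
  moreover have "h ` ?S = ?S" if h: "h \<in> H" for h
  proof -
    have "h (k y0) \<in> ?S" if "k \<in> H" for k
      using Hc[OF h that] by (intro image_eqI[of _ _ "h \<circ> k"]) auto
    then have "h ` ?S \<subseteq> ?S" by blast
    moreover have "k y0 \<in> h ` ?S" if k: "k \<in> H" for k
    proof -
      have "k y0 = h ((inv h \<circ> k) y0)" using h P(3) by auto
      then show ?thesis using Hc[OF Hi[OF h] k] by blast
    qed
    ultimately show ?thesis by blast
  qed
  ultimately show ?thesis unfolding sectional_def by blast
qed

text \<open>Oddness provides \<open>u\<close> outside \<open>H\<close> that fixes \<open>y\<close>.
  Precomposing with \<open>u\<close> brings an element into \<open>H\<close> without changing the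
  image of \<open>y\<close>.\<close>

lemma complement_vertex_transitive:
  assumes H: "is_complement H p Y G" and od: "\<not> even_stabilizers Y G' (\<lambda>g. g \<notin> H)"
  shows "vertex_transitive H Y"
  unfolding vertex_transitive_def
proof (intro ballI)
  note P = complement_parity[OF H]
  fix y y' assume y: "y \<in> verts Y" "y' \<in> verts Y"
  obtain g where g: "g \<in> G'" "g y = y'" using up.vertex_map y by blast
  obtain u where u: "u \<in> G'" "u y = y" "u \<notin> H" using up.even_stabilizersI[OF P(1) y(1)] od by blast
  show "\<exists>g\<in>H. g y = y'"
  proof (cases "g \<in> H")
    case False
    then have "g \<circ> u \<in> H" using up.parity_comp[OF P(1) g(1) u(1)] u by blast
    then show ?thesis using g u by (metis comp_apply)
  qed (use g in auto)
qed

end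

text \<open>The zero parity has even stabilizers, so a nonzero value is demanded explicitly.\<close>

definition has_even_parity :: "'v graph \<Rightarrow> ('v \<Rightarrow> 'v) set \<Rightarrow> bool" where
  "has_even_parity X G \<longleftrightarrow>
     (\<exists>\<chi>. parity_hom G \<chi> \<and> even_stabilizers X G \<chi> \<and> (\<exists>g\<in>G. \<chi> g))"

definition has_odd_parity :: "'v graph \<Rightarrow> ('v \<Rightarrow> 'v) set \<Rightarrow> bool" where
  "has_odd_parity X G \<longleftrightarrow> (\<exists>\<chi>. parity_hom G \<chi> \<and> \<not> even_stabilizers X G \<chi>)"

section \<open>Parities created by a split step\<close>

context lifted_two_cover
begin

lemma has_even_parity_lift: "has_even_parity X G \<Longrightarrow> has_even_parity Y G'"
proof -
  assume "has_even_parity X G"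
  then obtain \<chi> g where \<chi>: "parity_hom G \<chi>" "even_stabilizers X G \<chi>" "g \<in> G" "\<chi> g"
    unfolding has_even_parity_def by blast
  obtain g' where "g' \<in> G'" "\<pi> g' = g" using pi_surj'[OF \<chi>(3)] by blast
  then have "\<exists>g'\<in>G'. (\<chi> \<circ> \<pi>) g'" using \<chi>(4) by auto
  then show ?thesis
    using parity_pullback[OF \<chi>(1)] even_pullback[OF \<chi>(1)] \<chi>(2) unfolding has_even_parity_def by blast
qed

lemma has_odd_parity_lift: "has_odd_parity X G \<Longrightarrow> has_odd_parity Y G'"
  unfolding has_odd_parity_def using parity_pullback even_pullback by metis

text \<open>A nonzero even parity of the base would pull back to one that equals
  \<open>\<chi>\<close> by uniqueness, yet pullbacks vanish on \<open>\<tau>\<close>.\<close>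

lemma new_even_parity:
  assumes "parity_hom G' \<chi>" "even_stabilizers Y G' \<chi>" "\<chi> \<tau>"
  shows "has_even_parity Y G'" "\<not> has_even_parity X G"
proof -
  show "has_even_parity Y G'" unfolding has_even_parity_def using assms tau_G by blast
  show "\<not> has_even_parity X G"
  proof
    assume "has_even_parity X G"
    then obtain \<psi> where \<psi>: "parity_hom G \<psi>" "even_stabilizers X G \<psi>" "\<exists>g\<in>G. \<psi> g"
      unfolding has_even_parity_def by blast
    have "\<exists>g\<in>G'. (\<psi> \<circ> \<pi>) g" using \<psi>(3) pi_surj' by (metis comp_apply)
    then have "\<chi> \<tau> = (\<psi> \<circ> \<pi>) \<tau>"
      using up.even_stabilizers_unique[OF assms(1,2) _ parity_pullback[OF \<psi>(1)]]
        even_pullback[OF \<psi>(1)] \<psi>(2) assms(3) tau_G by blast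
    then show False using assms(3) parity_pullback_tau[OF \<psi>(1)] by blast
  qed
qed

text \<open>If the base already has an odd parity, subtracting its pullback makes the new parity even.\<close>

lemma new_parity:
  assumes \<chi>: "parity_hom G' \<chi>" "\<chi> \<tau>"
  shows "has_even_parity Y G' \<and> \<not> has_even_parity X G \<or> has_odd_parity Y G' \<and> \<not> has_odd_parity X G"
proof (cases "even_stabilizers Y G' \<chi>")
  case True
  then show ?thesis using new_even_parity \<chi> by blast
next
  case False
  then have o: "has_odd_parity Y G'" unfolding has_odd_parity_def using \<chi> by blast
  show ?thesis
  proof (cases "has_odd_parity X G")
    case True
    then obtain \<psi> where \<psi>: "parity_hom G \<psi>" "\<not> even_stabilizers X G \<psi>"
      unfolding has_odd_parity_def by blast
    note pb = parity_pullback[OF \<psi>(1)]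
    have "even_stabilizers Y G' (\<lambda>g. \<chi> g \<noteq> (\<psi> \<circ> \<pi>) g)"
      using up.odd_stabilizers_agree[OF \<chi>(1) False pb] even_pullback[OF \<psi>(1)] \<psi>(2) by blast
    then show ?thesis
      using new_even_parity[OF up.parity_add[OF \<chi>(1) pb]] \<chi>(2) parity_pullback_tau[OF \<psi>(1)] by blast
  qed (use o in blast)
qed

lemma split_new_parity:
  assumes "split_cover p Y G"
  shows "has_even_parity Y G' \<and> \<not> has_even_parity X G \<or> has_odd_parity Y G' \<and> \<not> has_odd_parity X G"
  using assms complement_parity new_parity unfolding split_cover_def by blast

text \<open>A complement that is not vertex-transitive has an even parity; being nonzero on
  \<open>\<tau>\<close>, it would be the first one.\<close>

lemma split_transitiveI:
  assumes "split_cover p Y G" "\<not> (has_even_parity Y G' \<and> \<not> has_even_parity X G)"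
  shows "split_transitive p Y X G"
  using assms complement_parity complement_vertex_transitive new_even_parity
  unfolding split_transitive_def by blast

text \<open>An even parity that does not come from the base is nonzero on \<open>\<tau>\<close>, and
  its kernel is a sectional complement. Any complement that is not sectional has an odd parity and
  is transitive, which gives the mixed case.\<close>

lemma split_sectional_or_mixed:
  assumes "has_even_parity Y G'" "\<not> has_even_parity X G"
  shows "split_sectional p Y X G \<or> split_mixed p Y X G"
proof -
  obtain \<chi> where \<chi>: "parity_hom G' \<chi>" "even_stabilizers Y G' \<chi>" "\<exists>g\<in>G'. \<chi> g"
    using assms(1) unfolding has_even_parity_def by blast
  have t: "\<chi> \<tau>"
  proof (rule ccontr)
    assume "\<not> \<chi> \<tau>"
    then obtain \<psi> where \<psi>: "parity_hom G \<psi>" "\<And>g'. g' \<in> G' \<Longrightarrow> \<chi> g' = (\<psi> \<circ> \<pi>) g'"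
      using parity_descends \<chi>(1) by blast
    have "even_stabilizers Y G' (\<psi> \<circ> \<pi>)" using \<chi>(2) \<psi>(2) by (simp add: even_stabilizers_def)
    then have "even_stabilizers X G \<psi>" using even_pullback[OF \<psi>(1)] by simp
    moreover have "\<exists>g\<in>G. \<psi> g" using \<chi>(3) \<psi>(2) pi_G by auto
    ultimately show False using assms(2) \<psi>(1) unfolding has_even_parity_def by blast
  qed
  let ?H = "{g \<in> G'. \<not> \<chi> g}"
  have H: "is_complement ?H p Y G" by (rule parity_complement[OF \<chi>(1) t])
  have "even_stabilizers Y G' (\<lambda>g. g \<notin> ?H)" using \<chi>(2) by (auto simp: even_stabilizers_def)
  then have s: "sectional ?H p Y X" by (rule complement_sectional[OF H])
  have sp: "split_cover p Y G" using H lft unfolding split_cover_def by blast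
  show ?thesis
  proof (cases "\<forall>H. is_complement H p Y G \<longrightarrow> sectional H p Y X")
    case True
    then show ?thesis using sp by (simp add: split_sectional_def)
  next
    case False
    then show ?thesis
      using sp H s complement_sectional complement_vertex_transitive unfolding split_mixed_def by blast
  qed
qed

end

section \<open>Counting split steps along the chain\<close>

theorem theorem5p3:
  fixes X :: "nat \<Rightarrow> 'v graph" and p :: "nat \<Rightarrow> 'v \<Rightarrow> 'v"
    and G :: "nat \<Rightarrow> ('v \<Rightarrow> 'v) set" and n :: nat
  assumes graphs: "\<forall>j\<le>n. simple_graph (X j) \<and> connected_graph (X j)"
    and cubic: "cubic (X 0)"
    and grp: "aut_subgroup (G 0) (X 0)"
    and arctr: "arc_transitive (G 0) (X 0)"
    and chain: "admissible_2chain X p G n"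
  shows "card {j \<in> {1..n}. split_cover (p j) (X j) (G (j - 1))} \<le> 2 \<and>
    (card {j \<in> {1..n}. split_cover (p j) (X j) (G (j - 1))} = 2 \<longrightarrow>
      (\<exists>j\<in>{1..n}. \<exists>k\<in>{1..n}. j \<noteq> k \<and>
          split_transitive (p j) (X j) (X (j - 1)) (G (j - 1)) \<and>
          (split_sectional (p k) (X k) (X (k - 1)) (G (k - 1)) \<or>
           split_mixed (p k) (X k) (X (k - 1)) (G (k - 1)))) \<and>
      (\<exists>s\<in>{2,3,5}. s_regular (G 0) (X 0) s))"
proof -
  have base: "cubic_arc_group (X 0) (G 0)"
    using graphs cubic grp arctr by unfold_locales auto
  have step: "lifted_two_cover (X j) (G j) (X (Suc j)) (p (Suc j))"
    "lifted_group (p (Suc j)) (X (Suc j)) (G j) = G (Suc j)"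
    if "Suc j \<le> n" "cubic_arc_group (X j) (G j)" for j
  proof -
    have "Suc j \<in> {1..n}" using that by simp
    then have c: "two_cover (p (Suc j)) (X (Suc j)) (X j)" "lifts (p (Suc j)) (X (Suc j)) (G j)"
      "G (Suc j) = lifted_group (p (Suc j)) (X (Suc j)) (G j)"
      using chain unfolding admissible_2chain_def by (metis diff_Suc_1)+
    interpret cubic_arc_group "X j" "G j" by fact
    show "lifted_two_cover (X j) (G j) (X (Suc j)) (p (Suc j))"
      using c graphs that by unfold_locales auto
    show "lifted_group (p (Suc j)) (X (Suc j)) (G j) = G (Suc j)" using c by simp
  qed
  obtain s where s: "1 \<le> s" "walk_transitive (G 0) (X 0) s" "walk_faithful (G 0) (X 0) s"
    using cubic_arc_group.ex_walk_regular[OF base] by metis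
  \<comment> \<open>One \<open>s\<close> serves every level, so a restriction on \<open>s\<close>
    found from an odd parity higher up applies to \<open>G 0\<close>.\<close>
  have all: "cubic_arc_group (X j) (G j) \<and> walk_transitive (G j) (X j) s \<and> walk_faithful (G j) (X j) s"
    if "j \<le> n" for j
    using that
  proof (induction j)
    case (Suc j)
    then have IH: "cubic_arc_group (X j) (G j)" "walk_transitive (G j) (X j) s" "walk_faithful (G j) (X j) s"
      by auto
    interpret lifted_two_cover "X j" "G j" "X (Suc j)" "p (Suc j)" using step Suc.prems IH by blast
    show ?case
      using up.cubic_arc_group_axioms walk_transitive_lift walk_faithful_lift IH s(1) step(2)[OF Suc.prems IH(1)]
      by simp
  qed (use base s in simp)
  have cov: "lifted_two_cover (X (j - 1)) (G (j - 1)) (X j) (p j)"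
    and lg: "lifted_group (p j) (X j) (G (j - 1)) = G j" if "j \<in> {1..n}" for j
    using step[of "j - 1"] all[of "j - 1"] that by auto
  let ?E = "\<lambda>j. has_even_parity (X j) (G j)" and ?O = "\<lambda>j. has_odd_parity (X j) (G j)"
  let ?S = "{j \<in> {1..n}. split_cover (p j) (X j) (G (j - 1))}"
  let ?JE = "{j \<in> {1..n}. ?E j \<and> \<not> ?E (j - 1)}" and ?JO = "{j \<in> {1..n}. ?O j \<and> \<not> ?O (j - 1)}"
  \<comment> \<open>A property inherited upwards can switch on at most once along the chain.\<close>
  have jump: "card {j \<in> {1..n}. P j \<and> \<not> P (j - 1)} \<le> 1"
    if up: "\<And>j. j \<in> {1..n} \<Longrightarrow> P (j - 1) \<Longrightarrow> P j" for P :: "nat \<Rightarrow> bool"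
  proof -
    have mono: "P k" if "j \<le> k" "k \<le> n" "P j" for j k
      using that
    proof (induction k rule: dec_induct)
      case (step m) then show ?case using up[of "Suc m"] by simp
    qed
    have "j = k" if "j \<in> {1..n}" "k \<in> {1..n}" "P j" "\<not> P (j - 1)" "P k" "\<not> P (k - 1)" for j k
    proof (rule linorder_cases[of j k])
      assume "j < k"
      then have "P (k - 1)" using mono[of j "k - 1"] that by auto
      then show ?thesis using that by blast
    next
      assume "k < j"
      then have "P (j - 1)" using mono[of k "j - 1"] that by auto
      then show ?thesis using that by blast
    qed
    then show "card {j \<in> {1..n}. P j \<and> \<not> P (j - 1)} \<le> 1"
      by (intro card_le_Suc0_iff_eq[THEN iffD2, folded One_nat_def]) auto
  qed
  have E_up: "?E (j - 1) \<Longrightarrow> ?E j" and O_up: "?O (j - 1) \<Longrightarrow> ?O j" if "j \<in> {1..n}" for j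
    using lifted_two_cover.has_even_parity_lift[OF cov[OF that]]
      lifted_two_cover.has_odd_parity_lift[OF cov[OF that]] lg[OF that] by auto
  have cE: "card ?JE \<le> 1" using jump[of ?E] E_up by blast
  have cO: "card ?JO \<le> 1" using jump[of ?O] O_up by blast
  have sub: "?S \<subseteq> ?JE \<union> ?JO"
  proof
    fix j assume "j \<in> ?S"
    then have j: "j \<in> {1..n}" "split_cover (p j) (X j) (G (j - 1))" by auto
    then show "j \<in> ?JE \<union> ?JO"
      using lifted_two_cover.split_new_parity[OF cov[OF j(1)] j(2)] lg[OF j(1)] by auto
  qed
  have "card ?S \<le> card (?JE \<union> ?JO)" using sub by (intro card_mono) auto
  also have "\<dots> \<le> card ?JE + card ?JO" by (rule card_Un_le)
  also have "\<dots> \<le> 2" using cE cO by simp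
  finally have le: "card ?S \<le> 2" .
  moreover have "(\<exists>j\<in>{1..n}. \<exists>k\<in>{1..n}. j \<noteq> k \<and>
          split_transitive (p j) (X j) (X (j - 1)) (G (j - 1)) \<and>
          (split_sectional (p k) (X k) (X (k - 1)) (G (k - 1)) \<or>
           split_mixed (p k) (X k) (X (k - 1)) (G (k - 1)))) \<and>
      (\<exists>s\<in>{2,3,5}. s_regular (G 0) (X 0) s)" if two: "card ?S = 2"
  proof -
    \<comment> \<open>Neither set has more than one element, so two split steps do not fit into one
      of them: one step creates the odd parity only, the other the even one only.\<close>
    have "\<not> ?S \<subseteq> ?JE" "\<not> ?S \<subseteq> ?JO"
      using card_mono[of ?JE ?S] card_mono[of ?JO ?S] cE cO two by auto
    then obtain j k where j: "j \<in> ?S" "j \<notin> ?JE" and k: "k \<in> ?S" "k \<notin> ?JO" by blast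
    then have jO: "j \<in> ?JO" and kE: "k \<in> ?JE" using sub by blast+
    have jn: "j \<in> {1..n}" "k \<in> {1..n}" using j k by auto
    have "split_transitive (p j) (X j) (X (j - 1)) (G (j - 1))"
      using lifted_two_cover.split_transitiveI[OF cov[OF jn(1)]] lg[OF jn(1)] j by auto
    moreover have "split_sectional (p k) (X k) (X (k - 1)) (G (k - 1)) \<or>
           split_mixed (p k) (X k) (X (k - 1)) (G (k - 1))"
      using lifted_two_cover.split_sectional_or_mixed[OF cov[OF jn(2)]] lg[OF jn(2)] kE by auto
    moreover have "j \<noteq> k" using j kE by blast
    moreover have "s \<in> {2, 3, 5}"
    proof -
      have "?O j" "j \<le> n" using jO by auto
      then show ?thesis using all[of j] s(1) cubic_arc_group.odd_stabilizers_regularity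
        unfolding has_odd_parity_def by metis
    qed
    moreover have "s_regular (G 0) (X 0) s"
      using cubic_arc_group.s_regular_of_walk_regular[OF base s(2,3)] .
    ultimately show ?thesis using jn by blast
  qed
  ultimately show ?thesis by blast
qed

end
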